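(* Let $\beta\in\mathbb{R}$ and let $\pi_n\in S_n$ be a Mallows random permutation, $\pi_n\sim M_{\beta,n}$. If $d_n(1),\dots,d_n(n)$ is the degree sequence of the associated permutation graph $G_{\pi_n}$, then the degree process $d_n(\cdot)$ converges in law to a stochastic process $Z(\cdot)$ on $(0,1]$. More precisely, for indices $0<r_1<r_2<\cdots<r_s\le1$, $$\left(\frac{d_n(\lceil nr_1\rceil)}{n},\frac{d_n(\lceil nr_2\rceil)}{n},\ldots,\frac{d_n(\lceil nr_s\rceil)}{n}\right)\to(D_{r_1,\beta},D_{r_2,\beta},\ldots,D_{r_s,\beta})\quad\text{in distribution},$$ where $D_{r_1,\beta},\ldots,D_{r_s,\beta}$ are independent and the law of $D_{a,\beta}$ is as follows. (1) If $a\notin[a_c(\beta),1-a_c(\beta)]$, then $D_{a,\beta}$ has density $$g_{a,\beta}(z)=\frac{\beta e^{\frac12\beta(a-z)}}{(1-e^{-\beta})\left(e^{\beta(a+z)}-e^\beta R(a,\beta)\right)^{1/2}},\qquad z\in[a,1-a].$$ (2) If $a\in(a_c(\beta),1-a_c(\beta))$, then $D_{a,\beta}$ has density $$g_{a,\beta}(z)=\begin{cases}\dfrac{\beta e^{\frac12\beta(a-z)}}{(1-e^{-\beta})\left(e^{\beta(a+z)}-e^\beta R(a,\beta)\right)^{1/2}}&\text{for } z\in[a,1-a],\\[3ex] \dfrac{2\beta e^{\frac12\beta(a-z)}}{(1-e^{-\beta})\left(e^{\beta(a+z)}-e^\beta R(a,\beta)\right)^{1/2}}&\text{for } z\in\left[1-a+\frac1\beta\log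 R(a,\beta),\ \min\{a,1-a\}\right).\end{cases}$$ Here $$R(a,\beta)=\frac{4(e^{\beta}-e^{a\beta})(e^{a\beta}-1)}{(e^\beta-1)^2},\qquad a_c(\beta)=\frac12-\frac{\log\cosh(\beta/2)}{\beta}.$$
   Context: $S_n$ is the set of permutations of $[n]=\{1,\dots,n\}$. The permutation graph $G_{\pi_n}$ of $\pi_n\in S_n$ has vertex set $[n]$ and an edge between $i$ and $j$ iff $(i-j)(\pi_n(i)-\pi_n(j))<0$; $d_n(i)$ is the degree of vertex $i$. The degree process is $d_n(t):=d_n(\lceil nt\rceil)/n$, $t\in(0,1]$; convergence in law of such processes means convergence in distribution of all finite dimensional distributions. $M_{\beta,n}$ is the Mallows measure on $S_n$ with probability mass function $m_{\beta,n}(\sigma)=e^{-\beta\lambda(\sigma)/n}\big/\sum_{\tau\in S_n}e^{-\beta\lambda(\tau)/n}$, where $\lambda(\sigma)$ is the number of inversions of $\sigma$, i.e. the number of pairs $i<j$ with $\sigma(i)>\sigma(j)$. The statement is for all real $\beta$, with the same formulas for $\beta<0$ as for $\beta>0$, under the convention that every interval written with endpoints $x,y$ (not necessarily $x\le y$) is read as the interval from $\min\{x,y\}$ to $\max\{x,y\}$. For $\beta=0$ (the uniform random permutation) all expressions are interpreted as their limits as $\beta\to0$; in particular $a_c(0)=1-a_c(0)=1/2$, so the interval in case (2) is empty. *)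

theory Defs
  imports
    "HOL-Probability.Probability"
    "HOL-Combinatorics.Permutations"
begin

definition perm_graph :: "nat \<Rightarrow> (nat \<Rightarrow> nat) \<Rightarrow> (nat \<times> nat) set" where
  "perm_graph n \<pi> = {(i, j). i \<in> {1..n} \<and> j \<in> {1..n} \<and>
     (int i - int j) * (int (\<pi> i) - int (\<pi> j)) < 0}"

lemma sym_perm_graph: "sym (perm_graph n \<pi>)"
  unfolding sym_def perm_graph_def by (auto simp: algebra_simps)

lemma irrefl_perm_graph: "irrefl (perm_graph n \<pi>)"
  unfolding irrefl_def perm_graph_def by auto

definition perm_graph_degree :: "nat \<Rightarrow> (nat \<Rightarrow> nat) \<Rightarrow> nat \<Rightarrow> nat" where
  "perm_graph_degree n \<pi> i = card {j. (i, j) \<in> perm_graph n \<pi>}"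

definition degree_process :: "nat \<Rightarrow> (nat \<Rightarrow> nat) \<Rightarrow> real \<Rightarrow> real" where
  "degree_process n \<pi> t = real (perm_graph_degree n \<pi> (nat \<lceil>real n * t\<rceil>)) / real n"

definition inversion_count :: "nat \<Rightarrow> (nat \<Rightarrow> nat) \<Rightarrow> nat" where
  "inversion_count n \<sigma> =
     card {(i, j). i \<in> {1..n} \<and> j \<in> {1..n} \<and> i < j \<and> \<sigma> i > \<sigma> j}"

definition mallows_mass :: "real \<Rightarrow> nat \<Rightarrow> (nat \<Rightarrow> nat) \<Rightarrow> real" where
  "mallows_mass \<beta> n \<sigma> = exp (- \<beta> * real (inversion_count n \<sigma>) / real n) /
     (\<Sum>\<tau> | \<tau> permutes {1..n}. exp (- \<beta> * real (inversion_count n \<tau>) / real n))"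

definition mallows_pmf :: "real \<Rightarrow> nat \<Rightarrow> (nat \<Rightarrow> nat) pmf" where
  "mallows_pmf \<beta> n = embed_pmf (\<lambda>\<sigma>. if \<sigma> permutes {1..n} then mallows_mass \<beta> n \<sigma> else 0)"

lemma pmf_mallows_pmf:
  "pmf (mallows_pmf \<beta> n) \<sigma> = (if \<sigma> permutes {1..n} then mallows_mass \<beta> n \<sigma> else 0)"
proof -
  let ?S = "{\<tau>. \<tau> permutes {1..n}}"
  let ?f = "\<lambda>\<sigma>. if \<sigma> permutes {1..n} then mallows_mass \<beta> n \<sigma> else 0"
  have fin: "finite ?S"
    by (rule finite_permutations) simp
  have "id \<in> ?S"
    by (simp add: permutes_id)
  then have pos: "(\<Sum>\<tau>\<in>?S. exp (- \<beta> * real (inversion_count n \<tau>) / real n)) > 0"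
    using fin by (intro sum_pos) (blast | simp)+
  have nonneg: "mallows_mass \<beta> n \<tau> \<ge> 0" for \<tau>
    unfolding mallows_mass_def by (intro divide_nonneg_nonneg sum_nonneg) auto
  have "(\<Sum>\<tau>\<in>?S. mallows_mass \<beta> n \<tau>) = 1"
    using pos unfolding mallows_mass_def sum_divide_distrib[symmetric] by simp
  moreover have "(\<integral>\<^sup>+ \<tau>. ennreal (?f \<tau>) \<partial>count_space UNIV) = (\<Sum>\<tau>\<in>?S. ennreal (?f \<tau>))"
    by (rule nn_integral_count_space'[OF fin]) auto
  ultimately have "(\<integral>\<^sup>+ \<tau>. ennreal (?f \<tau>) \<partial>count_space UNIV) = 1"
    using nonneg by (simp add: sum_ennreal)
  then show ?thesis
    unfolding mallows_pmf_def by (subst pmf_embed_pmf) (auto simp: nonneg)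
qed

text \<open>
  Weak convergence of the laws of the random elements \<open>X n\<close> of the topological space \<open>T\<close>
  (defined on possibly different probability spaces \<open>M n\<close>) to the law of \<open>Y\<close>, tested against
  bounded continuous functions. The space \<open>\<real>\<^sup>I\<close> is the product topology over \<open>I\<close>, whose points
  are the functions extensional on \<open>I\<close>.
\<close>

definition converges_in_distribution ::
    "'a topology \<Rightarrow> (nat \<Rightarrow> 'b measure) \<Rightarrow> (nat \<Rightarrow> 'b \<Rightarrow> 'a) \<Rightarrow> 'c measure \<Rightarrow> ('c \<Rightarrow> 'a) \<Rightarrow> bool" where
  "converges_in_distribution T M X N Y \<longleftrightarrow>
     (\<forall>f. continuous_map T euclideanreal f \<and> bounded (f ` topspace T) \<longrightarrow>
        (\<lambda>n. \<integral>\<omega>. f (X n \<omega>) \<partial>M n) \<longlonglongrightarrow> (\<integral>\<omega>. f (Y \<omega>) \<partial>N))"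

text \<open>The values at \<open>\<beta> = 0\<close> below are the limits as \<open>\<beta> \<rightarrow> 0\<close>; see the lemmas that follow.\<close>

definition mallows_R :: "real \<Rightarrow> real \<Rightarrow> real" where
  "mallows_R a \<beta> = (if \<beta> = 0 then 4 * (1 - a) * a
     else 4 * (exp \<beta> - exp (a * \<beta>)) * (exp (a * \<beta>) - 1) / (exp \<beta> - 1)\<^sup>2)"

definition mallows_ac :: "real \<Rightarrow> real" where
  "mallows_ac \<beta> = (if \<beta> = 0 then 1 / 2 else 1 / 2 - ln (cosh (\<beta> / 2)) / \<beta>)"

definition mallows_g :: "real \<Rightarrow> real \<Rightarrow> real \<Rightarrow> real" where
  "mallows_g a \<beta> z = (if \<beta> = 0 then 1 / sqrt (1 - mallows_R a 0)
     else \<beta> * exp (\<beta> * (a - z) / 2) /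
       ((1 - exp (- \<beta>)) * sqrt (exp (\<beta> * (a + z)) - exp \<beta> * mallows_R a \<beta>)))"

lemma mallows_R_tendsto: "((\<lambda>\<beta>. mallows_R a \<beta>) \<longlongrightarrow> mallows_R a 0) (at 0)"
proof -
  have q: "((\<lambda>\<beta>. (exp (c * \<beta>) - 1) / \<beta>) \<longlongrightarrow> c) (at 0)" for c :: real
  proof -
    have "((\<lambda>\<beta>. exp (c * \<beta>)) has_real_derivative c) (at 0)"
      by (auto intro!: derivative_eq_intros)
    then show ?thesis by (simp add: has_field_derivative_iff)
  qed
  have "((\<lambda>\<beta>. 4 * ((exp (1 * \<beta>) - 1) / \<beta> - (exp (a * \<beta>) - 1) / \<beta>) * ((exp (a * \<beta>) - 1) / \<beta>)
          / ((exp (1 * \<beta>) - 1) / \<beta>)\<^sup>2) \<longlongrightarrow> 4 * (1 - a) * a / 1\<^sup>2) (at 0)"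
    by (intro tendsto_intros q) simp
  moreover have "\<forall>\<^sub>F \<beta> in at 0. 4 * ((exp (1 * \<beta>) - 1) / \<beta> - (exp (a * \<beta>) - 1) / \<beta>) *
      ((exp (a * \<beta>) - 1) / \<beta>) / ((exp (1 * \<beta>) - 1) / \<beta>)\<^sup>2 = mallows_R a \<beta>"
    unfolding eventually_at_filter
    by (auto simp: mallows_R_def divide_simps power2_eq_square)
  ultimately show ?thesis
    by (auto simp: mallows_R_def elim: Lim_transform_eventually)
qed

lemma mallows_ac_tendsto: "(mallows_ac \<longlongrightarrow> mallows_ac 0) (at 0)"
proof -
  have "((\<lambda>\<beta>. ln (cosh (\<beta> / 2))) has_real_derivative 0) (at 0)"
    by (auto intro!: derivative_eq_intros)
  then have "((\<lambda>\<beta>::real. ln (cosh (\<beta> / 2)) / \<beta>) \<longlongrightarrow> 0) (at 0)"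
    by (simp add: has_field_derivative_iff)
  then have "((\<lambda>\<beta>::real. 1 / 2 - ln (cosh (\<beta> / 2)) / \<beta>) \<longlongrightarrow> 1 / 2 - 0) (at 0)"
    by (intro tendsto_intros)
  moreover have "\<forall>\<^sub>F \<beta> in at 0. 1 / 2 - ln (cosh (\<beta> / 2)) / \<beta> = mallows_ac \<beta>"
    unfolding eventually_at_filter by (auto simp: mallows_ac_def)
  ultimately show ?thesis
    by (auto simp: mallows_ac_def elim: Lim_transform_eventually)
qed

lemma mallows_g_tendsto:
  assumes "a \<noteq> 1 / 2"
  shows "((\<lambda>\<beta>. mallows_g a \<beta> z) \<longlongrightarrow> mallows_g a 0 z) (at 0)"
proof -
  have "((\<lambda>\<beta>. 1 - exp (- \<beta>)) has_real_derivative 1) (at 0)"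
    by (auto intro!: derivative_eq_intros)
  then have q: "((\<lambda>\<beta>. (1 - exp (- \<beta>)) / \<beta>) \<longlongrightarrow> (1::real)) (at 0)"
    by (simp add: has_field_derivative_iff)
  have sq: "1 - mallows_R a 0 = (1 - 2 * a)\<^sup>2"
    by (simp add: mallows_R_def power2_eq_square algebra_simps)
  then have nz: "sqrt (1 - mallows_R a 0) \<noteq> 0"
    using assms by simp
  have "((\<lambda>\<beta>. exp (\<beta> * (a - z) / 2) /
       ((1 - exp (- \<beta>)) / \<beta> * sqrt (exp (\<beta> * (a + z)) - exp \<beta> * mallows_R a \<beta>))) \<longlongrightarrow>
       exp (0 * (a - z) / 2) / (1 * sqrt (exp (0 * (a + z)) - exp 0 * mallows_R a 0))) (at 0)"
    using nz by (intro tendsto_intros q mallows_R_tendsto) auto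
  moreover have "\<forall>\<^sub>F \<beta> in at 0. exp (\<beta> * (a - z) / 2) /
       ((1 - exp (- \<beta>)) / \<beta> * sqrt (exp (\<beta> * (a + z)) - exp \<beta> * mallows_R a \<beta>)) = mallows_g a \<beta> z"
    unfolding eventually_at_filter by (auto simp: mallows_g_def)
  ultimately show ?thesis
    by (auto simp: mallows_g_def elim: Lim_transform_eventually)
qed

text \<open>
  Intervals with possibly unordered endpoints are segments. In the second density the first case
  takes precedence: for \<open>\<beta> < 0\<close> the point \<open>1 - a + ln (R a \<beta>) / \<beta>\<close> lies above \<open>max a (1 - a)\<close>, so the
  segment of the second case covers that of the first.
\<close>

definition degree_density_outer :: "real \<Rightarrow> real \<Rightarrow> real \<Rightarrow> real" where
  "degree_density_outer a \<beta> z = (if z \<in> closed_segment a (1 - a) then mallows_g a \<beta> z else 0)"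

definition degree_density_inner :: "real \<Rightarrow> real \<Rightarrow> real \<Rightarrow> real" where
  "degree_density_inner a \<beta> z =
     (if z \<in> closed_segment a (1 - a) then mallows_g a \<beta> z
      else if z \<in> closed_segment (1 - a + ln (mallows_R a \<beta>) / \<beta>) (min a (1 - a)) - {min a (1 - a)}
      then 2 * mallows_g a \<beta> z else 0)"

end

theory Submission imports Defs begin

text \<open>
  Let \<open>i\<close> be a position and let \<open>c i\<close> be the number of earlier positions that carry a larger value.
  The numbers \<open>c 1, \<dots>, c n\<close> form the Lehmer code of the permutation. The code is a bijection onto
  \<open>{0} \<times> {0,1} \<times> \<dots> \<times> {0,\<dots>,n-1}\<close> and its entries add up to the number of inversions, so under the
  Mallows measure the entries are independent and each is a truncated geometric variable
  (\<open>map_lehmer_code_mallows_pmf\<close>). The degree of \<open>i\<close> in the permutation graph is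
  \<open>2 * c i + \<pi> i - i\<close> (\<open>perm_graph_degree_lehmer\<close>). Asymptotic independence of the degrees at
  different positions therefore follows once \<open>\<pi> i\<close> is seen to be determined by \<open>c i\<close> alone, up to
  an error of order \<open>o(n)\<close>.

  For this, follow the rank \<open>X\<close> of the value \<open>\<pi> i\<close> among the first \<open>m\<close> values as \<open>m\<close> grows from
  \<open>i\<close>, where it equals \<open>i - c i\<close>, to \<open>n\<close>, where it equals \<open>\<pi> i\<close>. It is a Markov chain driven by the
  independent entries of the code. With \<open>E x = (1 - exp (- \<beta> * x)) / \<beta>\<close>, read as \<open>x\<close> when \<open>\<beta> = 0\<close>,
  the ratio \<open>E (X / n) / E ((m + 1) / n)\<close> is a martingale; its increments are of order \<open>1 / n\<close>, so its
  total variance is of order \<open>1 / n\<close> (\<open>insertion_rank_variance\<close>). In the limit, with \<open>i = a * n\<close> and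
  \<open>c i = C * n\<close>, the rescaled value \<open>Y\<close> satisfies \<open>E Y / E 1 = E (a - C) / E a\<close>, and the rescaled
  degree is \<open>2 * C + Y - a\<close>, a continuous function of \<open>C\<close>
  (\<open>degree_process_L2_approximation\<close>). The variables \<open>C\<close> have density \<open>exp (- \<beta> * c) / E a\<close> on
  \<open>[0, a]\<close> and are independent for distinct \<open>a\<close>. A coupling of the coordinates by Skorohod's theorem
  turns the convergence of the single entries into that of the vectors (\<open>weak_conv_m_PiM\<close>).

  It remains to push the law of \<open>C\<close> forward. For \<open>\<beta> = 0\<close> the degree is linear in \<open>C\<close>. Otherwise, with \<open>t = exp (- \<beta> * c)\<close> the limiting degree \<open>z\<close>
  satisfies \<open>exp (- \<beta> * z) = t * (E 1 - E (1 - a) * t) / E a\<close>, a quadratic polynomial in \<open>t\<close>. The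
  discriminant of this equation for \<open>t\<close> is, up to a positive factor, the expression under the square
  root in the density. The degree runs from
  \<open>1 - a\<close> at \<open>c = 0\<close> to \<open>a\<close> at \<open>c = a\<close>. It is monotone unless the vertex of the parabola lies inside the
  range of \<open>t\<close>, which happens exactly for \<open>a\<close> strictly between \<open>a\<^sub>c\<close> and \<open>1 - a\<^sub>c\<close>, because
  \<open>E a\<^sub>c = E 1 / 2\<close>. In that case the degree turns around at
  \<open>1 - a + log R / \<beta>\<close>, and the values between this point and the nearer end of the segment from \<open>a\<close> to
  \<open>1 - a\<close> are taken twice, whence the factor \<open>2\<close> in the second density.
\<close>

section \<open>The Lehmer code of a permutation\<close>

definition lehmer_digit :: "(nat \<Rightarrow> nat) \<Rightarrow> nat \<Rightarrow> nat" where
  "lehmer_digit \<pi> m = card {j \<in> {1..<m}. \<pi> j > \<pi> m}"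

definition lehmer_code :: "nat \<Rightarrow> (nat \<Rightarrow> nat) \<Rightarrow> nat \<Rightarrow> nat" where
  "lehmer_code n \<pi> m = (if m \<in> {1..n} then lehmer_digit \<pi> m else 0)"

text \<open>The rank of the \<open>i\<close>-th value among the first \<open>i + k\<close> values, computed from a code \<open>c\<close> alone. That it can
be computed from the code makes the code injective, and makes the rank a Markov chain when the
entries of the code are independent.\<close>
primrec insertion_rank :: "nat \<Rightarrow> (nat \<Rightarrow> nat) \<Rightarrow> nat \<Rightarrow> nat" where
  "insertion_rank i c 0 = i - c i"
| "insertion_rank i c (Suc k) =
     insertion_rank i c k + of_bool (i + Suc k \<le> c (i + Suc k) + insertion_rank i c k)"

text \<open>A new value at position \<open>m\<close> lies below \<open>\<pi> i\<close> exactly if all earlier values that are at least \<open>\<pi> i\<close>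
exceed it. There are \<open>m - X\<close> of them, where \<open>X\<close> is the rank among the first \<open>m - 1\<close> values, so this
means that the digit at \<open>m\<close> is at least \<open>m - X\<close>.\<close>
lemma insertion_rank_lehmer_code:
  assumes inj: "inj_on \<pi> {1..n}" and i: "1 \<le> i" and k: "i + k \<le> n"
  shows "insertion_rank i (lehmer_code n \<pi>) k = card {j \<in> {1..i + k}. \<pi> j \<le> \<pi> i}"
  using k
proof (induction k)
  case 0
  have "{j \<in> {1..i}. \<pi> j \<le> \<pi> i} = {1..i} - {j \<in> {1..<i}. \<pi> j > \<pi> i}"
    by (auto simp: le_less)
  then have "card {j \<in> {1..i}. \<pi> j \<le> \<pi> i} = i - lehmer_digit \<pi> i"
    by (simp add: card_Diff_subset lehmer_digit_def subset_iff)
  then show ?case using 0 i by (simp add: lehmer_code_def)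
next
  case (Suc k)
  let ?m = "i + Suc k"
  let ?A = "{j \<in> {1..i + k}. \<pi> j \<le> \<pi> i}"
  let ?C = "{j \<in> {1..<?m}. \<pi> j > \<pi> ?m}"
  have IH: "insertion_rank i (lehmer_code n \<pi>) k = card ?A"
    using Suc by simp
  have ne: "\<pi> ?m \<noteq> \<pi> i"
    using inj_onD[OF inj, of ?m i] i Suc.prems by auto
  have split: "card {j \<in> {1..i + k}. \<pi> j > \<pi> i} + card ?A = i + k"
  proof -
    have "{j \<in> {1..i + k}. \<pi> j > \<pi> i} \<union> ?A = {1..i + k}" by auto
    moreover have "card ({j \<in> {1..i + k}. \<pi> j > \<pi> i} \<union> ?A) =
        card {j \<in> {1..i + k}. \<pi> j > \<pi> i} + card ?A"
      by (intro card_Un_disjoint) auto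
    ultimately show ?thesis by simp
  qed
  have code: "lehmer_code n \<pi> ?m = card ?C"
    using Suc.prems by (simp add: lehmer_code_def lehmer_digit_def)
  show ?case
  proof (cases "\<pi> ?m < \<pi> i")
    case True
    have "insert i {j \<in> {1..i + k}. \<pi> j > \<pi> i} \<subseteq> ?C"
      using True i by auto
    then have "card (insert i {j \<in> {1..i + k}. \<pi> j > \<pi> i}) \<le> card ?C"
      by (intro card_mono) auto
    then have "?m \<le> card ?C + card ?A"
      using split by simp
    moreover have "{j \<in> {1..?m}. \<pi> j \<le> \<pi> i} = insert ?m ?A"
      using True by (auto simp: le_Suc_eq)
    then have "card {j \<in> {1..?m}. \<pi> j \<le> \<pi> i} = Suc (card ?A)" by simp
    ultimately show ?thesis using IH code by simp
  next
    case False
    have "?C \<subseteq> {j \<in> {1..i + k}. \<pi> j > \<pi> i}"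
      using False ne by auto
    then have "card ?C \<le> card {j \<in> {1..i + k}. \<pi> j > \<pi> i}"
      by (intro card_mono) auto
    then have "\<not> ?m \<le> card ?C + card ?A"
      using split by simp
    moreover have "{j \<in> {1..?m}. \<pi> j \<le> \<pi> i} = ?A"
      using False ne by (auto simp: le_Suc_eq)
    ultimately show ?thesis using IH code by simp
  qed
qed

lemma card_values_below_permutes:
  assumes "\<pi> permutes {1..n}" "i \<in> {1..n}"
  shows "card {j \<in> {1..n}. \<pi> j \<le> \<pi> i} = \<pi> i"
proof -
  have inj: "inj \<pi>" using assms(1) by (rule permutes_inj)
  have "\<pi> ` {j \<in> {1..n}. \<pi> j \<le> \<pi> i} = {1..\<pi> i}"
  proof (intro equalityI subsetI)
    fix y assume "y \<in> {1..\<pi> i}"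
    moreover have "\<pi> i \<in> {1..n}" using assms by (simp only: permutes_in_image)
    ultimately have "y \<in> \<pi> ` {1..n}" by (subst permutes_image[OF assms(1)]) auto
    with \<open>y \<in> {1..\<pi> i}\<close> show "y \<in> \<pi> ` {j \<in> {1..n}. \<pi> j \<le> \<pi> i}" by auto
  next
    fix y assume "y \<in> \<pi> ` {j \<in> {1..n}. \<pi> j \<le> \<pi> i}"
    then obtain j where j: "j \<in> {1..n}" "\<pi> j \<le> \<pi> i" "y = \<pi> j" by auto
    then have "\<pi> j \<in> {1..n}" using assms(1) by (simp only: permutes_in_image)
    then show "y \<in> {1..\<pi> i}" using j by auto
  qed
  then show ?thesis
    using card_image[of \<pi> "{j \<in> {1..n}. \<pi> j \<le> \<pi> i}"] inj by (simp add: inj_on_subset[OF inj])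
qed

lemma value_eq_insertion_rank:
  assumes "\<pi> permutes {1..n}" "i \<in> {1..n}"
  shows "\<pi> i = insertion_rank i (lehmer_code n \<pi>) (n - i)"
  using insertion_rank_lehmer_code[of \<pi> n i "n - i"] card_values_below_permutes[OF assms] assms
  by (simp add: permutes_inj_on)

lemma lehmer_digit_less: "1 \<le> m \<Longrightarrow> lehmer_digit \<pi> m < m"
proof -
  assume "1 \<le> m"
  have "lehmer_digit \<pi> m \<le> card {1..<m}"
    unfolding lehmer_digit_def by (intro card_mono) auto
  then show ?thesis using \<open>1 \<le> m\<close> by simp
qed

text \<open>The neighbours of \<open>i\<close> are the earlier larger and the later smaller values. The value \<open>\<pi> i\<close> counts
all values up to it, that is, the \<open>i - c i\<close> values up to it at positions at most \<open>i\<close> and the later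
smaller ones. Comparing the two counts eliminates the later smaller ones.\<close>
lemma perm_graph_degree_lehmer:
  assumes perm: "\<pi> permutes {1..n}" and i: "i \<in> {1..n}"
  shows "perm_graph_degree n \<pi> i + i = 2 * lehmer_digit \<pi> i + \<pi> i"
proof -
  let ?L = "{j \<in> {1..<i}. \<pi> j > \<pi> i}" and ?R = "{j \<in> {i<..n}. \<pi> j < \<pi> i}"
  have ne: "\<pi> j \<noteq> \<pi> i" if "j \<noteq> i" for j
    using permutes_inj[OF perm] that by (auto dest: injD)
  have "{j. (i, j) \<in> perm_graph n \<pi>} = ?L \<union> ?R"
    using i by (auto simp: perm_graph_def mult_less_0_iff)
  moreover have "card (?L \<union> ?R) = card ?L + card ?R"
    by (intro card_Un_disjoint) auto
  ultimately have deg: "perm_graph_degree n \<pi> i = lehmer_digit \<pi> i + card ?R"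
    by (simp add: perm_graph_degree_def lehmer_digit_def)
  have "{j \<in> {1..n}. \<pi> j \<le> \<pi> i} = ({1..i} - ?L) \<union> ?R"
    using i ne by (auto simp: le_less not_less)
  moreover have "card (({1..i} - ?L) \<union> ?R) = (i - card ?L) + card ?R"
  proof (subst card_Un_disjoint)
    have "card ({1..i} - ?L) = i - card ?L"
      by (subst card_Diff_subset) auto
    then show "card ({1..i} - ?L) + card ?R = i - card ?L + card ?R" by simp
  qed auto
  ultimately have "\<pi> i = i - lehmer_digit \<pi> i + card ?R"
    using card_values_below_permutes[OF assms] by (simp add: lehmer_digit_def)
  moreover have "lehmer_digit \<pi> i < i"
    using i by (intro lehmer_digit_less) auto
  ultimately show ?thesis using deg by simp
qed

lemma inversion_count_lehmer: "inversion_count n \<pi> = (\<Sum>m=1..n. lehmer_digit \<pi> m)"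
proof -
  have "{(i, j). i \<in> {1..n} \<and> j \<in> {1..n} \<and> i < j \<and> \<pi> i > \<pi> j} =
        (\<lambda>(m, j). (j, m)) ` (SIGMA m:{1..n}. {j \<in> {1..<m}. \<pi> j > \<pi> m})"
    by (force simp: image_iff)
  moreover have "inj_on (\<lambda>(m, j). (j, m)) (SIGMA m:{1..n}. {j \<in> {1..<m}. \<pi> j > \<pi> m})"
    by (auto intro!: inj_onI)
  ultimately show ?thesis
    by (simp add: inversion_count_def card_image lehmer_digit_def)
qed

text \<open>The last insertion rank recovers each \<open>\<pi> i\<close>, which gives injectivity. Surjectivity
follows from the count \<open>n!\<close> of both sides.\<close>
lemma bij_betw_lehmer_code:
  "bij_betw (lehmer_code n) {\<pi>. \<pi> permutes {1..n}} (PiE_dflt {1..n} 0 (\<lambda>m. {..<m}))"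
proof -
  let ?S = "{\<pi>. \<pi> permutes {1..n}}" and ?C = "PiE_dflt {1..n} 0 (\<lambda>m. {..<m::nat})"
  have inj: "inj_on (lehmer_code n) ?S"
  proof (rule inj_onI)
    fix \<pi> \<tau> assume *: "\<pi> \<in> ?S" "\<tau> \<in> ?S" "lehmer_code n \<pi> = lehmer_code n \<tau>"
    show "\<pi> = \<tau>"
    proof
      fix i show "\<pi> i = \<tau> i"
      proof (cases "i \<in> {1..n}")
        case True
        then show ?thesis
          using * value_eq_insertion_rank[of \<pi> n i] value_eq_insertion_rank[of \<tau> n i] by simp
      next
        case False
        have "\<pi> permutes {1..n}" "\<tau> permutes {1..n}" using * by auto
        then have "\<pi> i = i" "\<tau> i = i" using False by (blast intro: permutes_not_in)+
        then show ?thesis by simp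
      qed
    qed
  qed
  have sub: "lehmer_code n ` ?S \<subseteq> ?C"
    by (auto simp: PiE_dflt_def lehmer_code_def lehmer_digit_less)
  have fin: "finite ?C" by (intro finite_PiE_dflt) auto
  have "card ?C = (\<Prod>m=1..n. m)"
    by (subst card_PiE_dflt) auto
  also have "\<dots> = card ?S"
    by (subst card_permutations[OF refl]) (auto simp: fact_prod)
  also have "\<dots> = card (lehmer_code n ` ?S)"
    by (rule card_image[OF inj, symmetric])
  finally have "lehmer_code n ` ?S = ?C"
    using card_subset_eq[OF fin sub] by simp
  with inj show ?thesis by (simp add: bij_betw_def)
qed

section \<open>The law of the Lehmer code under the Mallows measure\<close>

text \<open>The integral of \<open>exp (- \<beta> * s)\<close> over \<open>[0, x]\<close>. With \<open>q = exp (- \<beta> / n)\<close>, the ratio of two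
\<open>q\<close>-integers is the ratio of two values of this function at multiples of \<open>1 / n\<close>; all signs of \<open>\<beta>\<close>,
and \<open>\<beta> = 0\<close>, are thus treated by the same formulas.\<close>
definition expint :: "real \<Rightarrow> real \<Rightarrow> real" where
  "expint \<beta> x = (if \<beta> = 0 then x else (1 - exp (- \<beta> * x)) / \<beta>)"

lemma expint_0 [simp]: "expint \<beta> 0 = 0"
  by (simp add: expint_def)

text \<open>The addition law of the \<open>q\<close>-integers; every exact computation below rests on it.\<close>
lemma expint_add: "expint \<beta> (x + y) = expint \<beta> x + exp (- \<beta> * x) * expint \<beta> y"
  by (simp add: expint_def field_simps exp_add[symmetric])

lemma expint_has_real_derivative [derivative_intros]:
  assumes "(f has_real_derivative f') (at x within S)"
  shows "((\<lambda>x. expint \<beta> (f x)) has_real_derivative exp (- \<beta> * f x) * f') (at x within S)"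
  unfolding expint_def using assms
  by (cases "\<beta> = 0") (auto intro!: derivative_eq_intros)

lemma continuous_on_expint [continuous_intros]:
  "continuous_on S f \<Longrightarrow> continuous_on S (\<lambda>x. expint \<beta> (f x))"
  unfolding expint_def by (cases "\<beta> = 0") (auto intro!: continuous_intros)

lemma tendsto_expint [tendsto_intros]:
  "(f \<longlongrightarrow> l) F \<Longrightarrow> ((\<lambda>x. expint \<beta> (f x)) \<longlongrightarrow> expint \<beta> l) F"
  unfolding expint_def by (cases "\<beta> = 0") (auto intro!: tendsto_intros)

lemma strict_mono_expint: "x < y \<Longrightarrow> expint \<beta> x < expint \<beta> y"
  by (rule DERIV_pos_imp_increasing)
     (auto intro!: exI[of _ "exp (- \<beta> * _)"] derivative_eq_intros)

lemma expint_mono: "x \<le> y \<Longrightarrow> expint \<beta> x \<le> expint \<beta> y"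
  using strict_mono_expint[of x y \<beta>] by (cases "x = y") auto

lemma expint_less_iff: "expint \<beta> x < expint \<beta> y \<longleftrightarrow> x < y"
  using strict_mono_expint[of x y \<beta>] expint_mono[of y x \<beta>] by (cases "x < y") auto

lemma expint_pos: "0 < x \<Longrightarrow> 0 < expint \<beta> x"
  using strict_mono_expint[of 0 x \<beta>] by simp

lemma expint_nonneg: "0 \<le> x \<Longrightarrow> 0 \<le> expint \<beta> x"
  using expint_mono[of 0 x \<beta>] by simp

text \<open>The truncated geometric distribution on \<open>{0,\<dots>,m-1}\<close> with ratio \<open>exp (- \<beta> / n)\<close>.\<close>
definition digit_pmf :: "real \<Rightarrow> nat \<Rightarrow> nat \<Rightarrow> nat pmf" where
  "digit_pmf \<beta> n m = embed_pmf (\<lambda>j. if j < m then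
     exp (- \<beta> * real j / real n) * expint \<beta> (1 / real n) / expint \<beta> (real m / real n) else 0)"

lemma sum_geometric_expint:
  assumes "n \<ge> 1"
  shows "(\<Sum>j<k. exp (- \<beta> * real j / real n) * expint \<beta> (1 / real n)) = expint \<beta> (real k / real n)"
proof (induction k)
  case (Suc k)
  have "expint \<beta> (real (Suc k) / real n) = expint \<beta> (real k / real n + 1 / real n)"
    by (simp add: add_divide_distrib add.commute)
  then show ?case using Suc by (simp add: expint_add)
qed simp

lemma pmf_digit_pmf:
  assumes "n \<ge> 1" "m \<ge> 1"
  shows "pmf (digit_pmf \<beta> n m) j = (if j < m then
     exp (- \<beta> * real j / real n) * expint \<beta> (1 / real n) / expint \<beta> (real m / real n) else 0)"
proof -
  let ?f = "\<lambda>j. if j < m then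
     exp (- \<beta> * real j / real n) * expint \<beta> (1 / real n) / expint \<beta> (real m / real n) else 0"
  have pos: "0 < expint \<beta> (real m / real n)" "0 < expint \<beta> (1 / real n)"
    using assms by (auto intro!: expint_pos)
  have nonneg: "0 \<le> ?f j" for j using pos by auto
  have "(\<integral>\<^sup>+ j. ennreal (?f j) \<partial>count_space UNIV) = (\<Sum>j<m. ennreal (?f j))"
    by (rule nn_integral_count_space') auto
  also have "\<dots> = ennreal (\<Sum>j<m. ?f j)"
    using nonneg by (intro sum_ennreal)
  also have "(\<Sum>j<m. ?f j) = (\<Sum>j<m. exp (- \<beta> * real j / real n) * expint \<beta> (1 / real n)) /
      expint \<beta> (real m / real n)"
    by (simp add: sum_divide_distrib)
  also have "\<dots> = 1"
    using pos sum_geometric_expint[OF assms(1)] by simp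
  finally show ?thesis
    unfolding digit_pmf_def using nonneg by (subst pmf_embed_pmf) auto
qed

lemma set_digit_pmf:
  assumes "n \<ge> 1" "m \<ge> 1"
  shows "set_pmf (digit_pmf \<beta> n m) = {..<m}"
proof -
  have "0 < expint \<beta> (real m / real n)" "0 < expint \<beta> (1 / real n)"
    using assms by (auto intro!: expint_pos)
  then show ?thesis
    by (auto simp: set_pmf_eq pmf_digit_pmf[OF assms])
qed

lemma prob_digit_pmf_less:
  assumes "n \<ge> 1" "m \<ge> 1"
  shows "measure_pmf.prob (digit_pmf \<beta> n m) {..<k} =
    expint \<beta> (real (min k m) / real n) / expint \<beta> (real m / real n)"
proof -
  have "measure_pmf.prob (digit_pmf \<beta> n m) {..<k} = (\<Sum>j<k. pmf (digit_pmf \<beta> n m) j)"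
    by (simp add: measure_measure_pmf_finite)
  also have "\<dots> = (\<Sum>j<min k m. pmf (digit_pmf \<beta> n m) j)"
    by (intro sum.mono_neutral_right) (auto simp: pmf_digit_pmf[OF assms])
  also have "\<dots> = (\<Sum>j<min k m. exp (- \<beta> * real j / real n) * expint \<beta> (1 / real n)) /
      expint \<beta> (real m / real n)"
    by (simp add: pmf_digit_pmf[OF assms] sum_divide_distrib)
  finally show ?thesis by (simp only: sum_geometric_expint[OF assms(1)])
qed

text \<open>The digits of the code add up to the number of inversions, so the Mallows weight is a product over the
digits.\<close>
lemma map_lehmer_code_mallows_pmf:
  assumes n: "n \<ge> 1"
  shows "map_pmf (lehmer_code n) (mallows_pmf \<beta> n) = Pi_pmf {1..n} 0 (digit_pmf \<beta> n)"
proof (rule pmf_eqI)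
  let ?S = "{\<pi>. \<pi> permutes {1..n}}" and ?C = "PiE_dflt {1..n} 0 (\<lambda>m. {..<m::nat})"
  let ?P = "Pi_pmf {1..n} 0 (digit_pmf \<beta> n)"
  define K where "K = (\<Prod>m=1..n. expint \<beta> (1 / real n) / expint \<beta> (real m / real n))"
  have fin: "finite ?S" by (rule finite_permutations) simp
  have finC: "finite ?C" by (intro finite_PiE_dflt) auto
  note bij = bij_betw_lehmer_code[of n]
  have K_pos: "K > 0"
    unfolding K_def using n by (intro prod_pos) (auto intro!: divide_pos_pos expint_pos)
  have setP: "set_pmf ?P = ?C"
    using n by (subst set_Pi_pmf) (auto simp: PiE_dflt_def set_digit_pmf)
  have weight: "pmf ?P (lehmer_code n \<pi>) = K * exp (- \<beta> * real (inversion_count n \<pi>) / real n)"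
    if "\<pi> \<in> ?S" for \<pi>
  proof -
    have "pmf ?P (lehmer_code n \<pi>) = (\<Prod>m=1..n. pmf (digit_pmf \<beta> n m) (lehmer_digit \<pi> m))"
      by (subst pmf_Pi) (auto simp: lehmer_code_def)
    also have "\<dots> = (\<Prod>m=1..n. exp (- \<beta> * real (lehmer_digit \<pi> m) / real n) *
        (expint \<beta> (1 / real n) / expint \<beta> (real m / real n)))"
      using n by (intro prod.cong) (auto simp: pmf_digit_pmf lehmer_digit_less)
    also have "\<dots> = exp (\<Sum>m=1..n. - \<beta> * real (lehmer_digit \<pi> m) / real n) * K"
      by (simp only: prod.distrib exp_sum K_def finite_atLeastAtMost)
    also have "(\<Sum>m=1..n. - \<beta> * real (lehmer_digit \<pi> m) / real n) =
        - \<beta> * real (inversion_count n \<pi>) / real n"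
      by (simp add: inversion_count_lehmer sum_divide_distrib[symmetric] sum_distrib_left sum_negf)
    finally show ?thesis by simp
  qed
  let ?Z = "\<Sum>\<tau>\<in>?S. exp (- \<beta> * real (inversion_count n \<tau>) / real n)"
  \<comment> \<open>Both families of weights are proportional on corresponding points and sum to \<open>1\<close>, so they agree;
    the partition function need not be evaluated.\<close>
  have "(\<Sum>c\<in>?C. pmf ?P c) = 1"
    using finC setP by (intro sum_pmf_eq_1) auto
  also have "(\<Sum>c\<in>?C. pmf ?P c) = (\<Sum>\<pi>\<in>?S. pmf ?P (lehmer_code n \<pi>))"
    by (rule sum.reindex_bij_betw[OF bij, symmetric])
  also have "\<dots> = K * ?Z"
    unfolding sum_distrib_left by (intro sum.cong refl weight)
  finally have KZ: "K * ?Z = 1" .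
  then have "?Z \<noteq> 0" by auto
  with KZ have K: "K = 1 / ?Z" by (metis nonzero_mult_div_cancel_right)
  have mass: "pmf ?P (lehmer_code n \<pi>) = mallows_mass \<beta> n \<pi>" if "\<pi> \<in> ?S" for \<pi>
    unfolding weight[OF that] mallows_mass_def K by simp
  have setM: "set_pmf (mallows_pmf \<beta> n) \<subseteq> ?S"
    by (auto simp: set_pmf_eq pmf_mallows_pmf)
  fix c
  show "pmf (map_pmf (lehmer_code n) (mallows_pmf \<beta> n)) c = pmf ?P c"
  proof (cases "c \<in> ?C")
    case True
    then obtain \<pi> where \<pi>: "\<pi> \<in> ?S" "c = lehmer_code n \<pi>"
      using bij by (auto simp: bij_betw_def)
    have "pmf (map_pmf (lehmer_code n) (mallows_pmf \<beta> n)) c =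
        measure_pmf.prob (mallows_pmf \<beta> n) (lehmer_code n -` {c})"
      by (rule pmf_map)
    also have "\<dots> = measure_pmf.prob (mallows_pmf \<beta> n) {\<pi>}"
    proof (rule measure_pmf.finite_measure_eq_AE)
      show "AE \<tau> in mallows_pmf \<beta> n. (\<tau> \<in> lehmer_code n -` {c}) = (\<tau> \<in> {\<pi>})"
        using setM \<pi> bij by (auto simp: AE_measure_pmf_iff bij_betw_def inj_on_def)
    qed auto
    also have "\<dots> = pmf ?P c"
      using \<pi> mass by (simp add: measure_pmf_single pmf_mallows_pmf)
    finally show ?thesis .
  next
    case False
    have "c \<notin> lehmer_code n ` set_pmf (mallows_pmf \<beta> n)"
      using False bij setM by (auto simp: bij_betw_def)
    then have "pmf (map_pmf (lehmer_code n) (mallows_pmf \<beta> n)) c = 0"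
      by (simp add: pmf_eq_0_set_pmf)
    moreover have "pmf ?P c = 0" using False setP by (simp add: pmf_eq_0_set_pmf)
    ultimately show ?thesis by simp
  qed
qed

section \<open>The insertion martingale\<close>

lemma expint_diff_le:
  assumes "\<bar>x\<bar> \<le> 2" "\<bar>y\<bar> \<le> 2"
  shows "\<bar>expint \<beta> x - expint \<beta> y\<bar> \<le> exp (2 * \<bar>\<beta>\<bar>) * \<bar>x - y\<bar>"
proof -
  have "norm (expint \<beta> x - expint \<beta> y) \<le> exp (2 * \<bar>\<beta>\<bar>) * norm (x - y)"
  proof (rule field_differentiable_bound[where S = "{-2..2}" and f' = "\<lambda>x. exp (- \<beta> * x)"])
    fix z :: real assume z: "z \<in> {-2..2}"
    show "(expint \<beta> has_field_derivative exp (- \<beta> * z)) (at z within {-2..2})"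
      by (auto intro!: derivative_eq_intros)
    have "\<bar>\<beta>\<bar> * \<bar>z\<bar> \<le> \<bar>\<beta>\<bar> * 2" using z by (intro mult_left_mono) auto
    then have "- (\<beta> * z) \<le> 2 * \<bar>\<beta>\<bar>" by (simp add: abs_mult[symmetric])
    then show "norm (exp (- \<beta> * z)) \<le> exp (2 * \<bar>\<beta>\<bar>)" by simp
  qed (use assms in auto)
  then show ?thesis by simp
qed

lemma expint_diff_ge:
  assumes "x \<in> {0..1}" "y \<in> {0..1}"
  shows "\<bar>x - y\<bar> \<le> exp \<bar>\<beta>\<bar> * \<bar>expint \<beta> x - expint \<beta> y\<bar>"
proof -
  have *: "y - x \<le> exp \<bar>\<beta>\<bar> * (expint \<beta> y - expint \<beta> x)" if "x < y" "0 \<le> x" "y \<le> 1" for x y :: real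
  proof -
    have "\<exists>z>x. z < y \<and> expint \<beta> y - expint \<beta> x = (y - x) * exp (- \<beta> * z)"
      by (rule MVT2[OF \<open>x < y\<close>]) (auto intro!: derivative_eq_intros)
    then obtain z where z: "x < z" "z < y" "expint \<beta> y - expint \<beta> x = (y - x) * exp (- \<beta> * z)"
      by auto
    have "\<bar>\<beta>\<bar> * \<bar>z\<bar> \<le> \<bar>\<beta>\<bar> * 1" using z that by (intro mult_left_mono) auto
    then have "0 \<le> \<bar>\<beta>\<bar> - \<beta> * z" using abs_ge_self[of "\<beta> * z"] by (simp add: abs_mult)
    then have "1 \<le> exp \<bar>\<beta>\<bar> * exp (- \<beta> * z)" by (simp add: exp_add[symmetric])
    then have "(y - x) * 1 \<le> (y - x) * (exp \<bar>\<beta>\<bar> * exp (- \<beta> * z))"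
      using that by (intro mult_left_mono) auto
    then show ?thesis using z(3) by (simp add: mult_ac)
  qed
  show ?thesis
    using *[of x y] *[of y x] expint_mono[of x y \<beta>] expint_mono[of y x \<beta>] assms
    by (cases x y rule: linorder_cases) auto
qed

text \<open>The parameters \<open>a \<le> b\<close> keep the first ratio at most \<open>1\<close>, so that an error in the denominator costs no
more than one in the numerator. Together with \<open>r\<close> as a lower bound of the denominators this gives a
Lipschitz bound for the martingale below.\<close>
lemma expint_ratio_diff_le:
  assumes r: "0 < r" "r \<le> b" "r \<le> b'" and a: "0 \<le> a" "a \<le> b" "0 \<le> a'"
    and le2: "b \<le> 2" "a' \<le> 2" "b' \<le> 2"
    and diff: "\<bar>a - a'\<bar> \<le> \<epsilon>" "\<bar>b - b'\<bar> \<le> \<epsilon>"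
  shows "\<bar>expint \<beta> a / expint \<beta> b - expint \<beta> a' / expint \<beta> b'\<bar> \<le>
    2 * exp (2 * \<bar>\<beta>\<bar>) * \<epsilon> / expint \<beta> r"
proof -
  let ?E = "expint \<beta>" and ?L = "exp (2 * \<bar>\<beta>\<bar>)"
  have pos: "0 < ?E r" "0 < ?E b" "0 < ?E b'" "?E r \<le> ?E b'" "0 \<le> ?E a" "?E a \<le> ?E b"
    using assms by (auto intro!: expint_pos expint_mono expint_nonneg)
  have eps: "0 \<le> \<epsilon>" using diff(1) abs_ge_zero order_trans by blast
  have "\<bar>?E a - ?E a'\<bar> \<le> ?L * \<bar>a - a'\<bar>" "\<bar>?E b - ?E b'\<bar> \<le> ?L * \<bar>b - b'\<bar>"
    using assms by (intro expint_diff_le; simp)+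
  moreover have "?L * \<bar>a - a'\<bar> \<le> ?L * \<epsilon>" "?L * \<bar>b - b'\<bar> \<le> ?L * \<epsilon>"
    using diff by (intro mult_left_mono; simp)+
  ultimately have L: "\<bar>?E a - ?E a'\<bar> \<le> ?L * \<epsilon>" "\<bar>?E b - ?E b'\<bar> \<le> ?L * \<epsilon>" by linarith+
  have "?E a / ?E b - ?E a' / ?E b' = ((?E a - ?E a') + ?E a / ?E b * (?E b' - ?E b)) / ?E b'"
    using pos by (simp add: field_simps)
  also have "\<bar>\<dots>\<bar> = \<bar>(?E a - ?E a') + ?E a / ?E b * (?E b' - ?E b)\<bar> / ?E b'"
    using pos by (simp add: abs_divide)
  also have "\<dots> \<le> (?L * \<epsilon> + 1 * (?L * \<epsilon>)) / ?E b'"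
  proof (intro divide_right_mono order_trans[OF abs_triangle_ineq] add_mono)
    show "\<bar>?E a / ?E b * (?E b' - ?E b)\<bar> \<le> 1 * (?L * \<epsilon>)"
      unfolding abs_mult using pos L(2) by (intro mult_mono) (auto simp: abs_minus_commute)
  qed (use L pos in auto)
  also have "\<dots> \<le> (?L * \<epsilon> + 1 * (?L * \<epsilon>)) / ?E r"
    using pos eps by (intro divide_left_mono) auto
  finally show ?thesis by (simp add: mult_ac)
qed

lemma expectation_cong_pmf:
  assumes "\<And>x. x \<in> set_pmf p \<Longrightarrow> f x = g x"
  shows "measure_pmf.expectation p f = measure_pmf.expectation p g"
  using assms by (intro integral_cong_AE) (auto simp: AE_measure_pmf_iff)

lemma expectation_Pi_pmf_insert:
  fixes F :: "(nat \<Rightarrow> nat) \<Rightarrow> real"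
  assumes "finite A" "x \<notin> A" and fin: "finite (set_pmf (p x))" "\<And>y. y \<in> A \<Longrightarrow> finite (set_pmf (p y))"
  shows "measure_pmf.expectation (Pi_pmf (insert x A) d p) F =
    measure_pmf.expectation (Pi_pmf A d p) (\<lambda>c. measure_pmf.expectation (p x) (\<lambda>y. F (c(x := y))))"
proof -
  have finA: "finite (set_pmf (Pi_pmf A d p))"
    using assms by (subst set_Pi_pmf) (auto intro: finite_PiE_dflt)
  have "Pi_pmf (insert x A) d p =
      bind_pmf (Pi_pmf A d p) (\<lambda>c. map_pmf (\<lambda>y. c(x := y)) (p x))"
    using assms(1,2)
    by (subst Pi_pmf_insert) (simp_all add: map_pmf_def pair_pmf_def bind_assoc_pmf bind_return_pmf
        bind_commute_pmf[of "p x"])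
  then show ?thesis
    using finA fin(1)
    by (simp add: pmf_expectation_bind[OF finA _ order_refl] integral_measure_pmf_real[OF finA]
        mult.commute)
qed

text \<open>A two-point variable with mean \<open>M\<close> that stays within \<open>K\<close> of \<open>M\<close> has variance at most \<open>K\<^sup>2\<close>. This
is one step of the orthogonality of martingale increments.\<close>
lemma expectation_square_step:
  fixes A B M M0 K :: real
  assumes fin: "finite (set_pmf p)"
    and mean: "measure_pmf.prob p S * A + (1 - measure_pmf.prob p S) * B = M"
    and K: "\<bar>M - A\<bar> \<le> K" "\<bar>M - B\<bar> \<le> K"
  shows "measure_pmf.expectation p (\<lambda>y. ((if y \<in> S then A else B) - M0)\<^sup>2) \<le> (M - M0)\<^sup>2 + K\<^sup>2"
proof -
  let ?p = "measure_pmf.prob p S"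
  have p01: "0 \<le> ?p" "?p \<le> 1" by auto
  have "measure_pmf.expectation p (\<lambda>y. ((if y \<in> S then A else B) - M0)\<^sup>2) =
      measure_pmf.expectation p (\<lambda>y. (B - M0)\<^sup>2 + ((A - M0)\<^sup>2 - (B - M0)\<^sup>2) * indicator S y)"
    by (intro expectation_cong_pmf) (auto simp: indicator_def)
  also have "\<dots> = (B - M0)\<^sup>2 + ((A - M0)\<^sup>2 - (B - M0)\<^sup>2) * ?p"
    using fin by (subst Bochner_Integration.integral_add) (auto intro: integrable_measure_pmf_finite)
  also have "\<dots> = ?p * (A - M0)\<^sup>2 + (1 - ?p) * (B - M0)\<^sup>2" by algebra
  also have "\<dots> = (M - M0)\<^sup>2 + (?p * (M - A)\<^sup>2 + (1 - ?p) * (M - B)\<^sup>2)"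
    unfolding mean[symmetric] by algebra
  also have "?p * (M - A)\<^sup>2 + (1 - ?p) * (M - B)\<^sup>2 \<le> ?p * K\<^sup>2 + (1 - ?p) * K\<^sup>2"
    using p01 K by (intro add_mono mult_left_mono) (auto simp: abs_le_square_iff[symmetric])
  also have "\<dots> = K\<^sup>2" by algebra
  finally show ?thesis by simp
qed

lemma insertion_rank_le:
  "insertion_rank i c k \<le> i + k"
  by (induction k) (auto simp: of_bool_def)

lemma insertion_rank_fun_upd:
  "i + k < m \<Longrightarrow> insertion_rank i (c(m := y)) k = insertion_rank i c k"
  by (induction k) auto

text \<open>With \<open>q\<close>-integers \<open>[k]\<close>, the rank \<open>x\<close> moves up at the insertion of the value at position \<open>m + 1\<close> with probability
\<open>q\<^bsup>m+1-x\<^esup> [x] / [m+1]\<close>, and then \<open>[x]\<close> gains \<open>q\<^sup>x\<close>. Its mean is therefore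
\<open>[x] (1 + q\<^bsup>m+1\<^esup> / [m+1]) = [x] [m+2] / [m+1]\<close>, so that division by \<open>[m+2]\<close>, respectively
\<open>[m+1]\<close>, yields a martingale.\<close>
lemma insertion_rank_martingale_step:
  fixes \<beta> :: real and n m x :: nat
  assumes n: "1 \<le> n" and m: "1 \<le> m" and x: "x \<le> m"
  defines "p \<equiv> measure_pmf.prob (digit_pmf \<beta> n (Suc m)) {j. Suc m \<le> j + x}"
  shows "p * (expint \<beta> (real (Suc x) / n) / expint \<beta> (real (m + 2) / n)) +
     (1 - p) * (expint \<beta> (real x / n) / expint \<beta> (real (m + 2) / n)) =
     expint \<beta> (real x / n) / expint \<beta> (real (m + 1) / n)"
proof -
  let ?E = "\<lambda>k. expint \<beta> (real k / n)"
  have "{j. Suc m \<le> j + x} = - {..<Suc m - x}" using x by auto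
  then have "p = 1 - measure_pmf.prob (digit_pmf \<beta> n (Suc m)) {..<Suc m - x}"
    unfolding p_def by (simp add: measure_pmf.prob_compl[of "{..<_}", simplified] Compl_eq_Diff_UNIV)
  also have "\<dots> = 1 - ?E (Suc m - x) / ?E (Suc m)"
    using n by (subst prob_digit_pmf_less) auto
  finally have p: "p = 1 - ?E (Suc m - x) / ?E (Suc m)" .
  define s where "s = exp (- \<beta> * (real (Suc m - x) / n))"
  define t where "t = exp (- \<beta> * (real x / n))"
  have add: "?E (a + b) = ?E a + exp (- \<beta> * (real a / n)) * ?E b" for a b
    by (simp only: of_nat_add add_divide_distrib expint_add)
  have E1: "?E (Suc m) = ?E (Suc m - x) + s * ?E x"
    using add[of "Suc m - x" x] x by (simp add: s_def)
  have E2: "?E (Suc x) = ?E x + t * ?E 1"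
    using add[of x 1] by (simp add: t_def)
  have "s * t = exp (- \<beta> * (real (Suc m - x) / n + real x / n))"
    unfolding s_def t_def exp_add[symmetric] by (simp add: algebra_simps)
  also have "real (Suc m - x) / n + real x / n = real (Suc m) / n"
    using x by (simp add: of_nat_diff add_divide_distrib[symmetric])
  finally have E3: "?E (m + 2) = ?E (Suc m) + s * t * ?E 1"
    using add[of "Suc m" 1] by simp
  have pos: "?E (Suc m) > 0" "?E (m + 2) > 0"
    using n by (auto intro!: expint_pos)
  have "p * ?E (Suc m) = s * ?E x"
    using p E1 pos by (simp add: field_simps)
  then have "(p * ?E (Suc x) + (1 - p) * ?E x) * ?E (Suc m) = ?E x * ?E (m + 2)"
    unfolding E2 E3 by algebra
  then show ?thesis using pos by (simp add: field_simps)
qed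

text \<open>The increments of the martingale are orthogonal and, as long as \<open>i\<close> is at least \<open>r * n\<close>, of order
\<open>1 / n\<close>. The sum of at most \<open>n\<close> squares of this order tends to zero.\<close>
lemma insertion_rank_variance:
  fixes i k n :: nat and r \<beta> :: real
  assumes i: "1 \<le> i" and k: "i + k \<le> n" and r: "0 < r" "r * n \<le> i"
  defines "M \<equiv> \<lambda>k c. expint \<beta> (real (insertion_rank i c k) / n) / expint \<beta> (real (i + k + 1) / n)"
  shows "measure_pmf.expectation (Pi_pmf {1..i + k} 0 (digit_pmf \<beta> n)) (\<lambda>c. (M k c - M 0 c)\<^sup>2)
    \<le> k * (2 * exp (2 * \<bar>\<beta>\<bar>) * (1 / n) / expint \<beta> r)\<^sup>2"
  using k
proof (induction k)
  case 0
  then show ?case by simp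
next
  case (Suc k)
  have n: "1 \<le> n" using i Suc.prems by simp
  let ?K = "2 * exp (2 * \<bar>\<beta>\<bar>) * (1 / n) / expint \<beta> r"
  let ?m = "i + k"
  let ?p = "digit_pmf \<beta> n"
  let ?P = "Pi_pmf {1..?m} 0 ?p"
  have fin: "finite (set_pmf (?p j))" if "1 \<le> j" for j
    using set_digit_pmf[OF n that] by simp
  have finP: "finite (set_pmf ?P)"
    using fin by (subst set_Pi_pmf) (auto intro!: finite_PiE_dflt)
  have step: "measure_pmf.expectation (?p (Suc ?m)) (\<lambda>y. (M (Suc k) (c(Suc ?m := y)) - M 0 (c(Suc ?m := y)))\<^sup>2)
      \<le> (M k c - M 0 c)\<^sup>2 + ?K\<^sup>2" for c
  proof -
    let ?x = "insertion_rank i c k"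
    let ?A = "expint \<beta> (real (Suc ?x) / n) / expint \<beta> (real (?m + 2) / n)"
    let ?B = "expint \<beta> (real ?x / n) / expint \<beta> (real (?m + 2) / n)"
    let ?S = "{j. Suc ?m \<le> j + ?x}"
    have x: "?x \<le> ?m" by (rule insertion_rank_le)
    \<comment> \<open>The starting value and the rank before the insertion only see digits up to position \<open>i + k\<close>, so the
      new digit can be integrated out first.\<close>
    have M0: "M 0 (c(Suc ?m := y)) = M 0 c" for y
      by (simp add: M_def)
    have M1: "M (Suc k) (c(Suc ?m := y)) = (if y \<in> ?S then ?A else ?B)" for y
      by (simp add: M_def insertion_rank_fun_upd add.commute)
    have ri: "r \<le> real ?m / n"
      using r n by (simp add: field_simps)
    have "?m + 2 \<le> 2 * n" using Suc.prems n i by simp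
    then have "real (?m + 2) \<le> real (2 * n)" by (simp only: of_nat_le_iff)
    then have le: "real (?m + 2) / n \<le> 2" using n by (simp add: field_simps)
    have le': "real ?m / n \<le> real (?m + 1) / n" "real (?m + 1) / n \<le> real (?m + 2) / n"
      "real ?x / n \<le> real (?m + 1) / n" "real ?x / n \<le> real (Suc ?x) / n"
      "real (Suc ?x) / n \<le> real (?m + 2) / n"
      using n x by (auto intro!: divide_right_mono)
    have diff: "real (Suc ?x) / n - real ?x / n = 1 / n" "real (?m + 2) / n - real (?m + 1) / n = 1 / n"
      by (simp_all add: diff_divide_distrib[symmetric])
    have A: "\<bar>M k c - ?A\<bar> \<le> ?K"
      unfolding M_def
      by (rule expint_ratio_diff_le) (use r ri le le' diff n in \<open>auto simp del: of_nat_add of_nat_Suc\<close>)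
    have B: "\<bar>M k c - ?B\<bar> \<le> ?K"
      unfolding M_def
      by (rule expint_ratio_diff_le) (use r ri le le' diff n in \<open>auto simp del: of_nat_add of_nat_Suc\<close>)
    show ?thesis
      unfolding M0 M1
    proof (rule expectation_square_step[OF fin _ A B])
      show "measure_pmf.prob (?p (Suc ?m)) ?S * ?A + (1 - measure_pmf.prob (?p (Suc ?m)) ?S) * ?B = M k c"
        unfolding M_def using insertion_rank_martingale_step[OF n _ x, of \<beta>] i by simp
    qed simp
  qed
  have "{1..i + Suc k} = insert (Suc ?m) {1..?m}" by auto
  then have "measure_pmf.expectation (Pi_pmf {1..i + Suc k} 0 ?p) (\<lambda>c. (M (Suc k) c - M 0 c)\<^sup>2) =
     measure_pmf.expectation ?P (\<lambda>c. measure_pmf.expectation (?p (Suc ?m))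
       (\<lambda>y. (M (Suc k) (c(Suc ?m := y)) - M 0 (c(Suc ?m := y)))\<^sup>2))"
    using fin by (simp only:, subst expectation_Pi_pmf_insert) auto
  also have "\<dots> \<le> measure_pmf.expectation ?P (\<lambda>c. (M k c - M 0 c)\<^sup>2 + ?K\<^sup>2)"
    using finP step by (intro integral_mono integrable_measure_pmf_finite)
  also have "\<dots> = measure_pmf.expectation ?P (\<lambda>c. (M k c - M 0 c)\<^sup>2) + ?K\<^sup>2"
    using finP by (subst Bochner_Integration.integral_add) (auto intro: integrable_measure_pmf_finite)
  also have "\<dots> \<le> k * ?K\<^sup>2 + ?K\<^sup>2"
    using Suc by simp
  also have "\<dots> = Suc k * ?K\<^sup>2" by (simp add: algebra_simps)
  finally show ?case .
qed

section \<open>The degree as a function of one Lehmer digit\<close>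

definition expint_inv :: "real \<Rightarrow> real \<Rightarrow> real" where
  "expint_inv \<beta> v = (if \<beta> = 0 then v else - ln (1 - \<beta> * v) / \<beta>)"

text \<open>The limit of \<open>\<pi> i / n\<close> when \<open>i / n\<close> tends to \<open>a\<close> and the digit at \<open>i\<close>, divided by \<open>n\<close>, tends to \<open>c\<close>: the
solution \<open>Y\<close> of \<open>E Y / E 1 = E (a - c) / E a\<close>, which says that the martingale has not moved.\<close>
definition limit_height :: "real \<Rightarrow> real \<Rightarrow> real \<Rightarrow> real" where
  "limit_height \<beta> a c = expint_inv \<beta> (expint \<beta> 1 * (expint \<beta> (a - c) / expint \<beta> a))"

text \<open>The argument is clamped to \<open>[0, a]\<close>, where it lies with probability one, to obtain a continuous
function on the whole line that can be composed with test functions.\<close>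
definition limit_degree :: "real \<Rightarrow> real \<Rightarrow> real \<Rightarrow> real" where
  "limit_degree \<beta> a c =
     2 * max 0 (min a c) + limit_height \<beta> a (max 0 (min a c)) - a"

lemma one_minus_expint: "1 - \<beta> * expint \<beta> x = exp (- \<beta> * x)"
  by (simp add: expint_def)

lemma expint_inv_expint [simp]: "expint_inv \<beta> (expint \<beta> x) = x"
  by (simp add: expint_inv_def one_minus_expint expint_def)

lemma expint_expint_inv:
  assumes "\<beta> * v < 1"
  shows "expint \<beta> (expint_inv \<beta> v) = v"
  using assms by (simp add: expint_def expint_inv_def)

lemma expint_range_less:
  assumes "v \<le> expint \<beta> x" "0 \<le> v"
  shows "\<beta> * v < 1"
proof (cases "\<beta> \<ge> 0")
  case True
  then have "\<beta> * v \<le> \<beta> * expint \<beta> x" using assms by (intro mult_left_mono) auto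
  also have "\<dots> < 1" using one_minus_expint[of \<beta> x] exp_gt_zero[of "- \<beta> * x"] by linarith
  finally show ?thesis .
next
  case False
  then have "\<beta> * v \<le> 0" using assms by (simp add: mult_nonpos_nonneg)
  then show ?thesis by linarith
qed

lemma expint_inv_range:
  assumes "0 \<le> v" "v \<le> expint \<beta> x"
  shows "expint_inv \<beta> v \<in> {0..x}"
proof -
  have v: "v = expint \<beta> (expint_inv \<beta> v)"
    using expint_expint_inv[OF expint_range_less[OF assms(2,1)]] by simp
  have "\<not> expint_inv \<beta> v < 0" "\<not> x < expint_inv \<beta> v"
    using assms v strict_mono_expint[of "expint_inv \<beta> v" 0 \<beta>]
      strict_mono_expint[of x "expint_inv \<beta> v" \<beta>] by auto
  then show ?thesis by auto
qed

lemma continuous_on_expint_inv [continuous_intros]: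
  assumes "continuous_on S f" "\<And>x. x \<in> S \<Longrightarrow> \<beta> * f x < 1"
  shows "continuous_on S (\<lambda>x. expint_inv \<beta> (f x))"
proof (cases "\<beta> = 0")
  case True
  then show ?thesis using assms(1) by (simp add: expint_inv_def)
next
  case False
  have "1 - \<beta> * f x \<noteq> 0" if "x \<in> S" for x using assms(2)[OF that] by simp
  then show ?thesis
    unfolding expint_inv_def using False assms(1) by (auto intro!: continuous_intros)
qed

lemma relative_height_range:
  assumes "0 < a" "c \<in> {0..a}"
  shows "0 \<le> expint \<beta> 1 * (expint \<beta> (a - c) / expint \<beta> a)"
    "expint \<beta> 1 * (expint \<beta> (a - c) / expint \<beta> a) \<le> expint \<beta> 1"
proof -
  have *: "0 < expint \<beta> a" "0 < expint \<beta> 1" "0 \<le> expint \<beta> (a - c)" "expint \<beta> (a - c) \<le> expint \<beta> a"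
    using assms by (auto intro!: expint_pos expint_nonneg expint_mono)
  then show "0 \<le> expint \<beta> 1 * (expint \<beta> (a - c) / expint \<beta> a)" by simp
  have "expint \<beta> (a - c) / expint \<beta> a \<le> 1" using * by (simp add: divide_le_eq)
  then show "expint \<beta> 1 * (expint \<beta> (a - c) / expint \<beta> a) \<le> expint \<beta> 1"
    using * mult_left_mono[of _ 1 "expint \<beta> 1"] by fastforce
qed

lemma limit_height_range:
  assumes "0 < a" "c \<in> {0..a}"
  shows "limit_height \<beta> a c \<in> {0..1}"
  unfolding limit_height_def
  by (rule expint_inv_range[OF relative_height_range[OF assms]])

lemma expint_limit_height:
  assumes "0 < a" "c \<in> {0..a}"
  shows "expint \<beta> (limit_height \<beta> a c) = expint \<beta> 1 * (expint \<beta> (a - c) / expint \<beta> a)"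
  unfolding limit_height_def using relative_height_range[OF assms]
  by (intro expint_expint_inv expint_range_less[of _ _ 1]) auto

lemma continuous_on_limit_degree:
  assumes "0 < a"
  shows "continuous_on UNIV (limit_degree \<beta> a)"
proof -
  have E: "expint \<beta> a \<noteq> 0" using expint_pos[OF assms, of \<beta>] by simp
  have "max 0 (min a c) \<in> {0..a}" for c using assms by auto
  then have "\<beta> * (expint \<beta> 1 * (expint \<beta> (a - max 0 (min a c)) / expint \<beta> a)) < 1" for c
    using relative_height_range[OF assms] expint_range_less[of _ \<beta> 1] by blast
  then show ?thesis
    unfolding limit_degree_def[abs_def] limit_height_def using E
    by (intro continuous_intros) auto
qed

lemma limit_degree_range:
  assumes "0 < a" "a \<le> 1"
  shows "limit_degree \<beta> a c \<in> {-1..2}"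
proof -
  have "max 0 (min a c) \<in> {0..a}" using assms by auto
  then show ?thesis
    using limit_height_range[OF assms(1), of "max 0 (min a c)" \<beta>] assms by (auto simp: limit_degree_def)
qed

lemma limit_degree_Icc:
  "c \<in> {0..a} \<Longrightarrow> limit_degree \<beta> a c = 2 * c + limit_height \<beta> a c - a"
  by (auto simp: limit_degree_def min_def max_def)

text \<open>The position whose degree the process reads off at time \<open>a\<close>.\<close>
definition site :: "nat \<Rightarrow> real \<Rightarrow> nat" where
  "site n a = nat \<lceil>real n * a\<rceil>"

lemma site_bounds:
  fixes a :: real
  assumes "n \<ge> 1" "0 < a" "a \<le> 1"
  shows "1 \<le> site n a" "site n a \<le> n" "a * n \<le> site n a" "site n a < a * n + 1"
proof -
  have pos: "0 < real n * a" using assms by simp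
  then have c: "1 \<le> \<lceil>real n * a\<rceil>" by linarith
  then show "1 \<le> site n a" by (simp add: site_def le_nat_iff)
  have r: "real (site n a) = real_of_int \<lceil>real n * a\<rceil>" using c by (simp add: site_def)
  have le: "real n * a \<le> real n * 1" using assms by (intro mult_left_mono) auto
  then have "\<lceil>real n * a\<rceil> \<le> int n" by (simp only: ceiling_le_iff of_int_of_nat_eq mult_1_right)
  then show "site n a \<le> n" by (simp only: site_def nat_le_iff)
  show "a * n \<le> site n a" "site n a < a * n + 1"
    unfolding r by (simp_all add: mult.commute) linarith+
qed

lemma degree_process_lehmer:
  assumes "\<pi> permutes {1..n}" "n \<ge> 1" "0 < a" "a \<le> 1"
  shows "degree_process n \<pi> a = 2 * (real (lehmer_digit \<pi> (site n a)) / n) +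
    real (\<pi> (site n a)) / n - real (site n a) / n"
proof -
  have i: "site n a \<in> {1..n}" using site_bounds[OF assms(2-4)] by auto
  from perm_graph_degree_lehmer[OF assms(1) i]
  have "real (perm_graph_degree n \<pi> (site n a)) =
      2 * real (lehmer_digit \<pi> (site n a)) + real (\<pi> (site n a)) - real (site n a)"
    by linarith
  then show ?thesis
    by (simp add: degree_process_def site_def[symmetric] add_divide_distrib diff_divide_distrib)
qed

lemma degree_process_range:
  "degree_process n \<pi> a \<in> {-1..2}"
proof -
  have "perm_graph_degree n \<pi> i \<le> card {1..n}" for i
    unfolding perm_graph_degree_def by (intro card_mono) (auto simp: perm_graph_def)
  then have "perm_graph_degree n \<pi> (nat \<lceil>real n * a\<rceil>) \<le> n" by simp
  then have "degree_process n \<pi> a \<le> 1" "0 \<le> degree_process n \<pi> a"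
    by (auto simp: degree_process_def divide_le_eq)
  then show ?thesis by auto
qed

text \<open>The first term on the right is the displacement of the martingale. The remaining error comes from
rounding: replacing \<open>(n + 1) / n\<close> by \<open>1\<close>, and \<open>i / n\<close> and \<open>(i + 1) / n\<close> by \<open>a\<close>. These two replacements
shift arguments by at most \<open>1 / n\<close> and \<open>2 / n\<close>, which is where the factor \<open>6 = 2 + 4\<close> in \<open>B\<close> comes
from.\<close>
lemma degree_limit_degree_dist:
  fixes n :: nat and a \<beta> :: real
  assumes n: "n \<ge> 1" and a: "0 < a" "a \<le> 1"
    and c: "c < site n a" and x: "x \<le> n"
  defines "i \<equiv> site n a"
  defines "B \<equiv> exp \<bar>\<beta>\<bar> * expint \<beta> 1 * (1 + 6 * exp (2 * \<bar>\<beta>\<bar>) / expint \<beta> a) + 1"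
  shows "\<bar>2 * (real c / n) + real x / n - real i / n - limit_degree \<beta> a (real c / n)\<bar> \<le>
    B * (\<bar>expint \<beta> (real x / n) / expint \<beta> (real (n + 1) / n) -
       expint \<beta> (real (i - c) / n) / expint \<beta> (real (i + 1) / n)\<bar> + 1 / real n)"
    (is "_ \<le> B * (\<bar>?M1 - ?M0\<bar> + 1 / real n)")
proof -
  let ?E = "expint \<beta>" and ?L = "exp (2 * \<bar>\<beta>\<bar>)"
  note site = site_bounds[OF n a, folded i_def]
  have ci: "c < i" using c by (simp add: i_def)
  have in': "a \<le> real i / n" "real i / n < a + 1 / n"
    using site n by (auto simp: field_simps)
  have "real c + 1 \<le> real i" using ci by linarith
  then have "real c \<le> a * n" using site(4) by linarith
  then have cr: "real c / n \<in> {0..a}" using n by (auto simp: field_simps)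
  define Y where "Y = limit_height \<beta> a (real c / n)"
  have Y: "Y \<in> {0..1}" "?E Y = ?E 1 * (?E (a - real c / n) / ?E a)"
    unfolding Y_def by (rule limit_height_range[OF a(1) cr] expint_limit_height[OF a(1) cr])+
  have xr: "real x / n \<in> {0..1}" using x n by auto
  have n1: "1 / real n \<le> 1" using n by simp
  have i1: "real i / n \<le> 1" using site n by simp
  have "\<bar>?E y / ?E 1 - ?E y / ?E (1 + e)\<bar> \<le> 2 * ?L * e / ?E a"
    if "0 \<le> y" "y \<le> 1" "0 \<le> e" "e \<le> 1" for y e
    by (rule expint_ratio_diff_le) (use a that in auto)
  from this[of "real x / n" "1 / n"] have d1: "\<bar>?E (real x / n) / ?E 1 - ?M1\<bar> \<le> 2 * ?L * (1 / n) / ?E a"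
    using xr n n1 by (simp add: add_divide_distrib add.commute)
  have ic: "real (i - c) / n = real i / n - real c / n" using ci by (simp add: of_nat_diff diff_divide_distrib)
  have cn: "0 \<le> real c / n" by simp
  have ci': "real c / n \<le> real i / n" using ci by (simp add: divide_right_mono)
  have "\<bar>?E (u - w) / ?E (u + e) - ?E (a - w) / ?E a\<bar> \<le> 2 * ?L * (2 * e) / ?E a"
    if "a \<le> u" "u < a + e" "u \<le> 1" "0 \<le> w" "w \<le> a" "w \<le> u" "0 \<le> e" "e \<le> 1" for u w e
    by (rule expint_ratio_diff_le) (use a that in auto)
  from this[of "real i / n" "1 / n" "real c / n"]
  have d2: "\<bar>?M0 - ?E (a - real c / n) / ?E a\<bar> \<le> 2 * ?L * (2 / n) / ?E a"
    unfolding ic using cr n1 in' i1 cn ci' by (simp add: add_divide_distrib add.commute)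
  have E1: "0 < ?E 1" and Ea: "0 < ?E a" using a by (auto intro: expint_pos)
  let ?d = "\<bar>?M1 - ?M0\<bar>"
  have "\<bar>real x / n - Y\<bar> \<le> exp \<bar>\<beta>\<bar> * \<bar>?E (real x / n) - ?E Y\<bar>"
    by (rule expint_diff_ge) (use xr Y in auto)
  also have "?E (real x / n) - ?E Y = ?E 1 * (?E (real x / n) / ?E 1 - ?E (a - real c / n) / ?E a)"
    using E1 by (simp add: Y algebra_simps)
  also have "\<bar>\<dots>\<bar> = ?E 1 * \<bar>?E (real x / n) / ?E 1 - ?E (a - real c / n) / ?E a\<bar>"
    using E1 by (simp add: abs_mult)
  also have "\<bar>?E (real x / n) / ?E 1 - ?E (a - real c / n) / ?E a\<bar> \<le>
      ?d + 2 * ?L * (1 / n) / ?E a + 2 * ?L * (2 / n) / ?E a"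
  proof -
    have "\<bar>p - q\<bar> \<le> \<bar>m1 - m0\<bar> + s + t" if "\<bar>p - m1\<bar> \<le> s" "\<bar>m0 - q\<bar> \<le> t" for p q m0 m1 s t :: real
      using that by linarith
    from this[OF d1 d2] show ?thesis .
  qed
  also have "\<dots> = ?d + 6 * ?L / ?E a * (1 / n)"
    by (simp add: field_simps)
  finally have "\<bar>real x / n - Y\<bar> \<le> exp \<bar>\<beta>\<bar> * (?E 1 * (?d + 6 * ?L / ?E a * (1 / n)))"
    using E1 by simp
  moreover have "2 * (real c / n) + real x / n - real i / n - limit_degree \<beta> a (real c / n) =
      (real x / n - Y) - (real i / n - a)"
    using cr by (simp add: limit_degree_Icc Y_def)
  ultimately have "\<bar>2 * (real c / n) + real x / n - real i / n - limit_degree \<beta> a (real c / n)\<bar> \<le>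
      exp \<bar>\<beta>\<bar> * (?E 1 * (?d + 6 * ?L / ?E a * (1 / n))) + 1 / n"
    using in' by linarith
  also have "\<dots> \<le> B * (?d + 1 / real n)"
  proof -
    have "exp \<bar>\<beta>\<bar> * (w * (d + l * e)) + e \<le> (exp \<bar>\<beta>\<bar> * w * (1 + l) + 1) * (d + e)"
      if "0 \<le> w" "0 \<le> d" "0 \<le> l" "0 \<le> e" for w d l e
    proof -
      have "0 \<le> exp \<bar>\<beta>\<bar> * w * l * d + exp \<bar>\<beta>\<bar> * w * e + d" using that by simp
      then show ?thesis by (simp add: algebra_simps)
    qed
    from this[of "?E 1" ?d "6 * ?L / ?E a" "1 / real n"] show ?thesis
      unfolding B_def using E1 Ea by (simp only: less_imp_le abs_ge_zero mult_nonneg_nonneg divide_nonneg_nonneg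
        exp_ge_zero of_nat_0_le_iff zero_le_numeral zero_le_one simp_thms)
  qed
  finally show ?thesis .
qed

lemma square_le_of_abs_le:
  fixes x B u e :: real
  assumes "\<bar>x\<bar> \<le> B * (\<bar>u\<bar> + e)"
  shows "x\<^sup>2 \<le> 2 * B\<^sup>2 * (u\<^sup>2 + e\<^sup>2)"
proof -
  have "x\<^sup>2 \<le> (B * (\<bar>u\<bar> + e))\<^sup>2"
    using power_mono[OF assms, of 2] by simp
  also have "\<dots> = B\<^sup>2 * (\<bar>u\<bar> + e)\<^sup>2" by (simp add: power_mult_distrib)
  also have "\<dots> \<le> B\<^sup>2 * (2 * (u\<^sup>2 + e\<^sup>2))"
    using zero_le_power2[of "\<bar>u\<bar> - e"] unfolding power2_diff power2_sum
    by (intro mult_left_mono) auto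
  finally show ?thesis by (simp add: algebra_simps)
qed

text \<open>The degree depends, up to a vanishing error in mean square, on the digit at its own position only.\<close>
lemma degree_process_L2_approximation:
  fixes a \<beta> :: real
  assumes a: "0 < a" "a \<le> 1"
  shows "(\<lambda>n. measure_pmf.expectation (mallows_pmf \<beta> n)
     (\<lambda>\<pi>. (degree_process n \<pi> a - limit_degree \<beta> a (real (lehmer_digit \<pi> (site n a)) / n))\<^sup>2)) \<longlonglongrightarrow> 0"
proof (rule tendsto_sandwich[OF _ _ tendsto_const])
  let ?L = "exp (2 * \<bar>\<beta>\<bar>)" and ?E = "expint \<beta>"
  define B where "B = exp \<bar>\<beta>\<bar> * ?E 1 * (1 + 6 * ?L / ?E a) + 1"
  define bound where "bound = (\<lambda>n::nat. 2 * B\<^sup>2 * (n * (2 * ?L * (1 / n) / ?E a)\<^sup>2 + (1 / real n)\<^sup>2))"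
  show "\<forall>\<^sub>F n in sequentially. measure_pmf.expectation (mallows_pmf \<beta> n)
     (\<lambda>\<pi>. (degree_process n \<pi> a - limit_degree \<beta> a (real (lehmer_digit \<pi> (site n a)) / n))\<^sup>2) \<le> bound n"
    using eventually_ge_at_top[of 1]
  proof eventually_elim
    case (elim n)
    define i where "i = site n a"
    note site = site_bounds[OF elim a, folded i_def]
    let ?P = "Pi_pmf {1..n} 0 (digit_pmf \<beta> n)"
    define M where "M = (\<lambda>k c. ?E (real (insertion_rank i c k) / n) / ?E (real (i + k + 1) / n))"
    define F where "F = (\<lambda>c. 2 * (real (c i) / n) + real (insertion_rank i c (n - i)) / n - real i / n
        - limit_degree \<beta> a (real (c i) / n))"
    have setP: "set_pmf ?P = PiE_dflt {1..n} 0 (\<lambda>m. {..<m})"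
      using elim by (subst set_Pi_pmf) (auto simp: PiE_dflt_def set_digit_pmf)
    have fin: "finite (set_pmf ?P)" unfolding setP by (intro finite_PiE_dflt) auto
    have "measure_pmf.expectation (mallows_pmf \<beta> n)
        (\<lambda>\<pi>. (degree_process n \<pi> a - limit_degree \<beta> a (real (lehmer_digit \<pi> i) / n))\<^sup>2) =
        measure_pmf.expectation (mallows_pmf \<beta> n) (\<lambda>\<pi>. (F (lehmer_code n \<pi>))\<^sup>2)"
    proof (rule expectation_cong_pmf)
      fix \<pi> assume "\<pi> \<in> set_pmf (mallows_pmf \<beta> n)"
      then have p: "\<pi> permutes {1..n}" by (auto simp: set_pmf_eq pmf_mallows_pmf split: if_splits)
      have i: "i \<in> {1..n}" using site by auto
      have "lehmer_code n \<pi> i = lehmer_digit \<pi> i" using i by (simp add: lehmer_code_def)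
      then show "(degree_process n \<pi> a - limit_degree \<beta> a (real (lehmer_digit \<pi> i) / n))\<^sup>2 =
          (F (lehmer_code n \<pi>))\<^sup>2"
        using degree_process_lehmer[OF p elim a, folded i_def] value_eq_insertion_rank[OF p i]
        by (simp add: F_def)
    qed
    also have "\<dots> = measure_pmf.expectation ?P (\<lambda>c. (F c)\<^sup>2)"
      using map_lehmer_code_mallows_pmf[OF elim, of \<beta>, symmetric] by simp
    also have "\<dots> \<le> measure_pmf.expectation ?P (\<lambda>c. 2 * B\<^sup>2 * ((M (n - i) c - M 0 c)\<^sup>2 + (1 / real n)\<^sup>2))"
    proof (intro integral_mono_AE)
      show "AE c in measure_pmf ?P. (F c)\<^sup>2 \<le> 2 * B\<^sup>2 * ((M (n - i) c - M 0 c)\<^sup>2 + (1 / real n)\<^sup>2)"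
      proof (rule AE_pmfI)
        fix c assume c: "c \<in> set_pmf ?P"
        then have ci: "c i < i" unfolding setP using site by (auto simp: PiE_dflt_def)
        have "insertion_rank i c (n - i) \<le> n" using insertion_rank_le[of i c "n - i"] site by simp
        from degree_limit_degree_dist[OF elim a ci[unfolded i_def] this, of \<beta>, folded i_def B_def]
        have "\<bar>F c\<bar> \<le> B * (\<bar>M (n - i) c - M 0 c\<bar> + 1 / real n)"
          using site by (simp add: F_def M_def)
        then show "(F c)\<^sup>2 \<le> 2 * B\<^sup>2 * ((M (n - i) c - M 0 c)\<^sup>2 + (1 / real n)\<^sup>2)"
          by (rule square_le_of_abs_le)
      qed
    qed (use fin in \<open>auto intro: integrable_measure_pmf_finite\<close>)
    also have "\<dots> = 2 * B\<^sup>2 * (measure_pmf.expectation ?P (\<lambda>c. (M (n - i) c - M 0 c)\<^sup>2) + (1 / real n)\<^sup>2)"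
      using fin by (simp add: integrable_measure_pmf_finite)
    also have "\<dots> \<le> 2 * B\<^sup>2 * (real (n - i) * (2 * ?L * (1 / n) / ?E a)\<^sup>2 + (1 / real n)\<^sup>2)"
    proof (intro mult_left_mono add_right_mono)
      show "measure_pmf.expectation ?P (\<lambda>c. (M (n - i) c - M 0 c)\<^sup>2) \<le>
          real (n - i) * (2 * ?L * (1 / n) / ?E a)\<^sup>2"
        using insertion_rank_variance[of i "n - i" n a \<beta>] site a unfolding M_def by simp
    qed simp
    also have "\<dots> \<le> bound n"
      unfolding bound_def by (intro mult_left_mono add_right_mono mult_right_mono) auto
    finally show ?case unfolding i_def .
  qed
  have "bound = (\<lambda>n. 2 * B\<^sup>2 * ((2 * ?L / ?E a)\<^sup>2 * (1 / n) + (1 / real n)\<^sup>2))"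
    by (auto simp: bound_def fun_eq_iff power2_eq_square)
  also have "\<dots> \<longlonglongrightarrow> 2 * B\<^sup>2 * ((2 * ?L / ?E a)\<^sup>2 * 0 + 0\<^sup>2)"
    by (intro tendsto_intros lim_1_over_n)
  finally show "bound \<longlonglongrightarrow> 0" by simp
qed (simp add: integral_nonneg_AE)

section \<open>The limiting law of a Lehmer digit\<close>

text \<open>The limit of the truncated geometric distribution on \<open>{0,\<dots>,i-1}\<close>, scaled by \<open>1 / n\<close>.\<close>
definition limit_digit_law :: "real \<Rightarrow> real \<Rightarrow> real measure" where
  "limit_digit_law \<beta> a =
     density lborel (\<lambda>x. ennreal (exp (- \<beta> * x) / expint \<beta> a) * indicator {0..a} x)"

lemma sets_limit_digit_law [simp, measurable_cong]: "sets (limit_digit_law \<beta> a) = sets borel"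
  by (simp add: limit_digit_law_def)

lemma space_limit_digit_law [simp]: "space (limit_digit_law \<beta> a) = UNIV"
  by (simp add: limit_digit_law_def)

lemma emeasure_limit_digit_law:
  assumes a: "0 < a" and A: "A \<in> sets borel" "A \<inter> {0..a} = {0..b}" and b: "0 \<le> b"
  shows "emeasure (limit_digit_law \<beta> a) A = ennreal (expint \<beta> b / expint \<beta> a)"
proof -
  have E: "0 < expint \<beta> a" using a by (rule expint_pos)
  have "emeasure (limit_digit_law \<beta> a) A =
      (\<integral>\<^sup>+x. ennreal (exp (- \<beta> * x) / expint \<beta> a) * indicator {0..a} x * indicator A x \<partial>lborel)"
    unfolding limit_digit_law_def using A(1) by (subst emeasure_density) auto
  also have "\<dots> = (\<integral>\<^sup>+x. ennreal (exp (- \<beta> * x) / expint \<beta> a) * indicator {0..b} x \<partial>lborel)"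
    unfolding A(2)[symmetric] by (intro nn_integral_cong) (auto split: split_indicator)
  also have "\<dots> = ennreal (expint \<beta> b / expint \<beta> a - expint \<beta> 0 / expint \<beta> a)"
    using E b by (intro nn_integral_FTC_Icc) (auto intro!: derivative_eq_intros)
  finally show ?thesis by simp
qed

lemma real_distribution_limit_digit_law:
  assumes "0 < a"
  shows "real_distribution (limit_digit_law \<beta> a)"
proof -
  have "emeasure (limit_digit_law \<beta> a) UNIV = ennreal (expint \<beta> a / expint \<beta> a)"
    using assms by (intro emeasure_limit_digit_law) auto
  then have "prob_space (limit_digit_law \<beta> a)"
    using expint_pos[OF assms, of \<beta>] by (intro prob_spaceI) simp
  then show ?thesis
    by (intro real_distribution.intro real_distribution_axioms.intro) auto
qed

lemma cdf_limit_digit_law: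
  assumes "0 < a"
  shows "cdf (limit_digit_law \<beta> a) x = (if x < 0 then 0 else expint \<beta> (min x a) / expint \<beta> a)"
proof (cases "x < 0")
  case True
  have "emeasure (limit_digit_law \<beta> a) {..x} = 0"
    unfolding limit_digit_law_def using True
    by (subst emeasure_density) (auto simp: nn_integral_0_iff_AE split: split_indicator intro!: AE_I2)
  then show ?thesis using True by (simp add: cdf_def measure_def)
next
  case False
  have "emeasure (limit_digit_law \<beta> a) {..x} = ennreal (expint \<beta> (min x a) / expint \<beta> a)"
    using assms False by (intro emeasure_limit_digit_law) auto
  then show ?thesis
    using False expint_pos[OF assms, of \<beta>] expint_nonneg[of "min x a" \<beta>] assms
    by (simp add: cdf_def measure_def)
qed

definition scaled_digit_law :: "real \<Rightarrow> real \<Rightarrow> nat \<Rightarrow> real measure" where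
  "scaled_digit_law \<beta> a n = distr (measure_pmf (digit_pmf \<beta> n (site n a))) borel (\<lambda>j. real j / real n)"

lemma real_distribution_scaled_digit_law: "real_distribution (scaled_digit_law \<beta> a n)"
  unfolding scaled_digit_law_def
  by (rule prob_space.real_distribution_distr[OF measure_pmf.prob_space_axioms]) simp

lemma cdf_scaled_digit_law:
  assumes n: "n \<ge> 1" and a: "0 < a" "a \<le> 1"
  shows "cdf (scaled_digit_law \<beta> a n) x = (if x < 0 then 0 else
    expint \<beta> (min ((of_int \<lfloor>real n * x\<rfloor> + 1) / real n) (real (site n a) / real n)) /
    expint \<beta> (real (site n a) / real n))"
proof -
  let ?i = "site n a"
  have i: "1 \<le> ?i" using site_bounds[OF n a] by simp
  have cdf: "cdf (scaled_digit_law \<beta> a n) x = measure_pmf.prob (digit_pmf \<beta> n ?i) {j. real j / n \<le> x}"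
    unfolding cdf_def scaled_digit_law_def by (subst measure_distr) (auto simp: vimage_def)
  show ?thesis
  proof (cases "x < 0")
    case True
    then have "{j. real j / n \<le> x} = {}"
      by (auto simp: not_le intro: less_le_trans)
    then show ?thesis using True cdf by simp
  next
    case False
    let ?k = "nat (\<lfloor>real n * x\<rfloor> + 1)"
    have nonneg: "0 \<le> \<lfloor>real n * x\<rfloor>" using False by simp
    have "real j / n \<le> x \<longleftrightarrow> j < ?k" for j
    proof -
      have "real j / n \<le> x \<longleftrightarrow> real j \<le> real n * x" using n by (simp add: field_simps)
      also have "\<dots> \<longleftrightarrow> int j \<le> \<lfloor>real n * x\<rfloor>" by (simp add: le_floor_iff)
      also have "\<dots> \<longleftrightarrow> j < ?k" using nonneg by linarith
      finally show ?thesis .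
    qed
    then have "{j. real j / n \<le> x} = {..<?k}" by auto
    then have "cdf (scaled_digit_law \<beta> a n) x =
        expint \<beta> (real (min ?k ?i) / n) / expint \<beta> (real ?i / n)"
      using cdf prob_digit_pmf_less[OF n i] by simp
    also have "real (min ?k ?i) / n = min (real ?k / n) (real ?i / n)"
      using n by (auto simp: min_def divide_le_cancel)
    also have "real ?k = of_int \<lfloor>real n * x\<rfloor> + 1" using nonneg by simp
    finally show ?thesis using False by simp
  qed
qed

lemma scaled_site_tendsto:
  assumes "0 < a" "a \<le> 1"
  shows "(\<lambda>n. real (site n a) / real n) \<longlonglongrightarrow> a"
proof (rule tendsto_sandwich)
  show "\<forall>\<^sub>F n in sequentially. a \<le> real (site n a) / real n"
    using eventually_ge_at_top[of 1]
    by eventually_elim (use site_bounds[OF _ assms] in \<open>auto simp: field_simps\<close>)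
  show "\<forall>\<^sub>F n in sequentially. real (site n a) / real n \<le> a + 1 / real n"
    using eventually_ge_at_top[of 1]
    by eventually_elim (use site_bounds[OF _ assms] in \<open>auto simp: field_simps intro: less_imp_le\<close>)
  have "(\<lambda>n. a + 1 / real n) \<longlonglongrightarrow> a + 0" by (intro tendsto_intros lim_1_over_n)
  then show "(\<lambda>n. a + 1 / real n) \<longlonglongrightarrow> a" by simp
qed auto

lemma scaled_floor_tendsto:
  "(\<lambda>n. (of_int \<lfloor>real n * x\<rfloor> + 1) / real n) \<longlonglongrightarrow> (x :: real)"
proof (rule tendsto_sandwich)
  show "\<forall>\<^sub>F n in sequentially. x \<le> (of_int \<lfloor>real n * x\<rfloor> + 1) / real n"
    using eventually_gt_at_top[of 0]
  proof eventually_elim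
    case (elim n)
    have "real n * x \<le> of_int \<lfloor>real n * x\<rfloor> + 1" by linarith
    then show ?case using elim by (simp add: pos_le_divide_eq mult.commute)
  qed
  show "\<forall>\<^sub>F n in sequentially. (of_int \<lfloor>real n * x\<rfloor> + 1) / real n \<le> x + 1 / real n"
    using eventually_gt_at_top[of 0]
  proof eventually_elim
    case (elim n)
    have "of_int \<lfloor>real n * x\<rfloor> + 1 \<le> real n * x + 1" by linarith
    then have "(of_int \<lfloor>real n * x\<rfloor> + 1) / real n \<le> (real n * x + 1) / real n"
      by (rule divide_right_mono) simp
    then show ?case using elim by (simp add: add_divide_distrib)
  qed
  have "(\<lambda>n. x + 1 / real n) \<longlonglongrightarrow> x + 0" by (intro tendsto_intros lim_1_over_n)
  then show "(\<lambda>n. x + 1 / real n) \<longlonglongrightarrow> x" by simp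
qed auto

text \<open>Both distribution functions are explicit ratios of values of \<open>expint\<close>, which is continuous.\<close>
lemma weak_conv_scaled_digit_law:
  assumes a: "0 < a" "a \<le> 1"
  shows "weak_conv_m (scaled_digit_law \<beta> a) (limit_digit_law \<beta> a)"
  unfolding weak_conv_m_def weak_conv_def
proof (intro allI impI)
  fix x
  let ?g = "\<lambda>n. if x < 0 then 0 else
    expint \<beta> (min ((of_int \<lfloor>real n * x\<rfloor> + 1) / real n) (real (site n a) / real n)) /
    expint \<beta> (real (site n a) / real n)"
  have E: "expint \<beta> a \<noteq> 0" using expint_pos[OF a(1), of \<beta>] by simp
  have "(\<lambda>n. expint \<beta> (min ((of_int \<lfloor>real n * x\<rfloor> + 1) / real n) (real (site n a) / real n)) /
    expint \<beta> (real (site n a) / real n)) \<longlonglongrightarrow> expint \<beta> (min x a) / expint \<beta> a"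
    using E by (intro tendsto_intros scaled_floor_tendsto scaled_site_tendsto a)
  then have "?g \<longlonglongrightarrow> cdf (limit_digit_law \<beta> a) x"
    by (auto simp: cdf_limit_digit_law[OF a(1)])
  moreover have "\<forall>\<^sub>F n in sequentially. ?g n = cdf (scaled_digit_law \<beta> a n) x"
    using eventually_ge_at_top[of 1] by eventually_elim (simp add: cdf_scaled_digit_law a)
  ultimately show "(\<lambda>n. cdf (scaled_digit_law \<beta> a n) x) \<longlonglongrightarrow> cdf (limit_digit_law \<beta> a) x"
    by (rule Lim_transform_eventually)
qed

section \<open>Weak convergence of product measures\<close>

text \<open>Points of the product topology over \<open>I\<close> are extensional functions. Restricting arbitrary
functions transports the question to the type of all functions, whose Borel sets are those of the
product \<open>\<sigma>\<close>-algebra because the index type is countable.\<close>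
lemma continuous_map_product_borel_measurable:
  fixes f :: "(nat \<Rightarrow> real) \<Rightarrow> real"
  assumes f: "continuous_map (product_topology (\<lambda>_. euclideanreal) I) euclideanreal f"
  shows "continuous_on UNIV (\<lambda>x. f (restrict x I))"
    and "f \<in> borel_measurable (PiM I (\<lambda>_. borel))"
proof -
  have "continuous_map (product_topology (\<lambda>_. euclideanreal) UNIV)
      (product_topology (\<lambda>_. euclideanreal) I) (\<lambda>x. restrict x I)"
    by (auto simp: continuous_map_componentwise restrict_def extensional_def intro!: continuous_map_product_projection)
  from continuous_map_compose[OF this f]
  show cont: "continuous_on UNIV (\<lambda>x. f (restrict x I))"
    by (simp add: euclidean_product_topology o_def continuous_map_iff_continuous2)
  have "(\<lambda>x. f (restrict x I)) \<in> borel_measurable borel"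
    by (rule borel_measurable_continuous_onI[OF cont])
  then have m: "(\<lambda>x. f (restrict x I)) \<in> borel_measurable (PiM UNIV (\<lambda>_. borel))"
    by (simp add: measurable_cong_sets[OF sets_PiM_equal_borel refl])
  have ext: "(\<lambda>x i. if i \<in> I then x i else 0) \<in> measurable (PiM I (\<lambda>_. borel)) (PiM UNIV (\<lambda>_. borel :: real measure))"
  proof (rule measurable_PiM_single')
    fix i :: nat
    show "(\<lambda>x. if i \<in> I then x i else 0) \<in> borel_measurable (PiM I (\<lambda>_. borel :: real measure))"
      by (cases "i \<in> I") auto
  qed (auto simp: space_PiM)
  have "f \<in> borel_measurable (PiM I (\<lambda>_. borel)) \<longleftrightarrow>
      (\<lambda>x. f (restrict x I)) \<circ> (\<lambda>x i. if i \<in> I then x i else 0) \<in> borel_measurable (PiM I (\<lambda>_. borel))"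
  proof (rule measurable_cong)
    fix x assume "x \<in> space (PiM I (\<lambda>_. borel :: real measure))"
    then have "restrict (\<lambda>i. if i \<in> I then x i else 0) I = x"
      by (auto simp: space_PiM PiE_def extensional_def restrict_def)
    then show "f x = ((\<lambda>x. f (restrict x I)) \<circ> (\<lambda>x i. if i \<in> I then x i else 0)) x" by simp
  qed
  then show "f \<in> borel_measurable (PiM I (\<lambda>_. borel))"
    using measurable_comp[OF ext m] by simp
qed

text \<open>The empty index set, for which the space is a single point, is treated apart; it corresponds to an
empty list of times.\<close>
lemma (in prob_space) distr_indep_vars_PiM:
  assumes "indep_vars (\<lambda>_. borel :: real measure) X I"
  shows "distr M (PiM I (\<lambda>_. borel)) (\<lambda>\<omega>. \<lambda>i\<in>I. X i \<omega>) = PiM I (\<lambda>i. distr M borel (X i))"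
proof (cases "I = {}")
  case True
  have "distr M (PiM {} (\<lambda>_. borel :: real measure)) (\<lambda>\<omega>. \<lambda>i\<in>{}. X i \<omega>) = PiM {} (\<lambda>i. distr M borel (X i))"
    (is "?D = _")
  proof (rule measure_eqI)
    fix A assume "A \<in> sets ?D"
    then consider "A = {}" | "A = {\<lambda>_. undefined}"
      by (auto simp: sets_PiM_empty)
    then show "emeasure ?D A = emeasure (PiM {} (\<lambda>i. distr M borel (X i))) A"
    proof cases
      case 2
      then show ?thesis
        by (subst emeasure_distr) (auto simp: sets_PiM_empty restrict_def emeasure_space_1)
    qed simp
  qed (simp add: sets_PiM_empty)
  then show ?thesis using True by simp
next
  case False
  have "X i \<in> borel_measurable M" if "i \<in> I" for i
    using assms that by (simp add: indep_vars_def)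
  then show ?thesis
    using indep_vars_iff_distr_eq_PiM'[OF False, of X "\<lambda>_. borel"] assms by simp
qed

lemma (in prob_space) expectation_indep_vars:
  assumes ind: "indep_vars (\<lambda>_. borel :: real measure) X I"
    and f: "f \<in> borel_measurable (PiM I (\<lambda>_. borel))"
  shows "(\<integral>\<omega>. f (\<lambda>i\<in>I. X i \<omega>) \<partial>M) = (\<integral>x. (f x :: real) \<partial>PiM I (\<lambda>i. distr M borel (X i)))"
proof -
  have "(\<lambda>\<omega>. \<lambda>i\<in>I. X i \<omega>) \<in> measurable M (PiM I (\<lambda>_. borel))"
    using ind by (intro measurable_restrict) (simp add: indep_vars_def)
  from integral_distr[OF this f] show ?thesis
    by (simp add: distr_indep_vars_PiM[OF ind])
qed

lemma indep_vars_PiM_coordinates: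
  assumes "\<And>i. i \<in> J \<Longrightarrow> prob_space (M i)" and J: "f \<in> I \<rightarrow> J" "inj_on f I"
  shows "prob_space.indep_vars (PiM J M) (\<lambda>i. M (f i)) (\<lambda>i \<omega>. \<omega> (f i)) I"
proof -
  interpret prob_space "PiM J M" using assms(1) by (rule prob_space_PiM)
  show ?thesis
  proof (cases "I = {}")
    case True
    then show ?thesis by (simp add: indep_vars_def indep_sets_def)
  next
    case False
    have comp: "distr (PiM J M) (M (f i)) (\<lambda>\<omega>. \<omega> (f i)) = M (f i)" if "i \<in> I" for i
      using assms that by (intro distr_PiM_component) auto
    have "distr (PiM J M) (PiM I (\<lambda>i. M (f i))) (\<lambda>\<omega>. \<lambda>i\<in>I. \<omega> (f i)) = PiM I (\<lambda>i. M (f i))"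
      using assms by (intro distr_PiM_reindex) auto
    also have "\<dots> = PiM I (\<lambda>i. distr (PiM J M) (M (f i)) (\<lambda>\<omega>. \<omega> (f i)))"
      by (intro PiM_cong) (simp_all add: comp)
    finally show ?thesis
      using J by (subst indep_vars_iff_distr_eq_PiM'[OF False])
        (auto intro!: measurable_component_singleton)
  qed
qed

lemma (in prob_space) indep_vars_reindex_inj:
  assumes inj: "inj_on f I" and ind: "indep_vars M' X (f ` I)"
  shows "indep_vars (\<lambda>i. M' (f i)) (\<lambda>i. X (f i)) I"
proof -
  let ?F = "\<lambda>i. {X i -` A \<inter> space M |A. A \<in> sets (M' i)}"
  have F: "indep_sets ?F (f ` I)" and rv: "\<forall>i\<in>f ` I. random_variable (M' i) (X i)"
    using ind by (auto simp: indep_vars_def2)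
  have "indep_sets (\<lambda>i. ?F (f i)) I"
  proof (rule indep_setsI)
    fix i assume "i \<in> I"
    then show "?F (f i) \<subseteq> events" using F by (auto simp: indep_sets_def)
  next
    fix A J assume J: "J \<noteq> {}" "J \<subseteq> I" "finite J" and A: "\<forall>j\<in>J. A j \<in> ?F (f j)"
    define A' where "A' = A \<circ> inv_into J f"
    have injJ: "inj_on f J" using inj J(2) by (rule inj_on_subset)
    have A': "A' (f j) = A j" if "j \<in> J" for j
      using that injJ by (simp add: A'_def)
    have "prob (\<Inter>k\<in>f ` J. A' k) = (\<Prod>k\<in>f ` J. prob (A' k))"
      using J A A' by (intro indep_setsD[OF F]) auto
    moreover have "(\<Inter>k\<in>f ` J. A' k) = (\<Inter>j\<in>J. A j)" using A' by simp
    moreover have "(\<Prod>k\<in>f ` J. prob (A' k)) = (\<Prod>j\<in>J. prob (A j))"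
      using A' by (simp add: prod.reindex[OF injJ])
    ultimately show "prob (\<Inter>j\<in>J. A j) = (\<Prod>j\<in>J. prob (A j))" by simp
  qed
  then show ?thesis using rv by (auto simp: indep_vars_def2)
qed

text \<open>By Skorohod's theorem each coordinate can be realised by random variables that converge everywhere.
On the product of the underlying spaces they remain independent and converge jointly, so dominated
convergence applies.\<close>
lemma weak_conv_m_PiM:
  fixes f :: "(nat \<Rightarrow> real) \<Rightarrow> real"
  assumes \<mu>: "\<And>n k. k \<in> I \<Longrightarrow> real_distribution (\<mu> n k)"
    and \<nu>: "\<And>k. k \<in> I \<Longrightarrow> real_distribution (\<nu> k)"
    and conv: "\<And>k. k \<in> I \<Longrightarrow> weak_conv_m (\<lambda>n. \<mu> n k) (\<nu> k)"
    and f: "continuous_map (product_topology (\<lambda>_. euclideanreal) I) euclideanreal f"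
      "bounded (f ` topspace (product_topology (\<lambda>_. euclideanreal) I))"
  shows "(\<lambda>n. \<integral>x. f x \<partial>PiM I (\<mu> n)) \<longlonglongrightarrow> (\<integral>x. f x \<partial>PiM I \<nu>)"
proof -
  let ?coupling = "\<lambda>k (\<Omega> :: real measure, Yn :: nat \<Rightarrow> real \<Rightarrow> real, Y :: real \<Rightarrow> real).
    prob_space \<Omega> \<and> (\<forall>n. Yn n \<in> borel_measurable \<Omega>) \<and> (\<forall>n. distr \<Omega> borel (Yn n) = \<mu> n k) \<and>
    Y \<in> borel_measurable \<Omega> \<and> distr \<Omega> borel Y = \<nu> k \<and> (\<forall>x \<in> space \<Omega>. (\<lambda>n. Yn n x) \<longlonglongrightarrow> Y x)"
  have "\<exists>T. ?coupling k T" if "k \<in> I" for k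
    using Skorohod[OF \<mu>[OF that] \<nu>[OF that] conv[OF that]]
    unfolding split_paired_Ex prod.case measurable_lborel1 .
  then have "\<forall>k\<in>I. \<exists>T. ?coupling k T" by blast
  then obtain T where T: "\<forall>k\<in>I. ?coupling k (T k)" by (rule bchoice[THEN exE])
  define \<Omega> where "\<Omega> k = fst (T k)" for k
  define Yn where "Yn k = fst (snd (T k))" for k
  define Y where "Y k = snd (snd (T k))" for k
  have \<Omega>: "prob_space (\<Omega> k)"
    and Yn: "Yn k n \<in> borel_measurable (\<Omega> k)" "distr (\<Omega> k) borel (Yn k n) = \<mu> n k"
    and Y: "Y k \<in> borel_measurable (\<Omega> k)" "distr (\<Omega> k) borel (Y k) = \<nu> k"
    and lim: "x \<in> space (\<Omega> k) \<Longrightarrow> (\<lambda>n. Yn k n x) \<longlonglongrightarrow> Y k x"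
    if "k \<in> I" for k n x
    using bspec[OF T that] by (simp_all add: \<Omega>_def Yn_def Y_def split_beta)
  interpret prob_space "PiM I \<Omega>" using \<Omega> by (rule prob_space_PiM)
  have indep: "indep_vars (\<lambda>k. \<Omega> k) (\<lambda>k \<omega>. \<omega> k) I"
    using indep_vars_PiM_coordinates[of I \<Omega> "\<lambda>x. x" I] \<Omega> by simp
  have law: "(\<integral>\<omega>. f (\<lambda>k\<in>I. V k (\<omega> k)) \<partial>PiM I \<Omega>) = (\<integral>x. f x \<partial>PiM I (\<lambda>k. distr (\<Omega> k) borel (V k)))"
    and meas: "(\<lambda>\<omega>. f (\<lambda>k\<in>I. V k (\<omega> k))) \<in> borel_measurable (PiM I \<Omega>)"
    if V: "\<And>k. k \<in> I \<Longrightarrow> V k \<in> borel_measurable (\<Omega> k)" for V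
  proof -
    have ind: "indep_vars (\<lambda>_. borel) (\<lambda>k \<omega>. V k (\<omega> k)) I"
      by (rule indep_vars_compose2[OF indep V])
    have "distr (PiM I \<Omega>) borel (\<lambda>\<omega>. V k (\<omega> k)) = distr (\<Omega> k) borel (V k)" if "k \<in> I" for k
    proof -
      have "distr (\<Omega> k) borel (V k) = distr (distr (PiM I \<Omega>) (\<Omega> k) (\<lambda>\<omega>. \<omega> k)) borel (V k)"
        using that \<Omega> by (simp add: distr_PiM_component)
      also have "\<dots> = distr (PiM I \<Omega>) borel (\<lambda>\<omega>. V k (\<omega> k))"
        using that V by (subst distr_distr) (auto simp: o_def)
      finally show ?thesis ..
    qed
    then have "PiM I (\<lambda>k. distr (PiM I \<Omega>) borel (\<lambda>\<omega>. V k (\<omega> k))) = PiM I (\<lambda>k. distr (\<Omega> k) borel (V k))"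
      by (intro PiM_cong) auto
    then show "(\<integral>\<omega>. f (\<lambda>k\<in>I. V k (\<omega> k)) \<partial>PiM I \<Omega>) = (\<integral>x. f x \<partial>PiM I (\<lambda>k. distr (\<Omega> k) borel (V k)))"
      using expectation_indep_vars[OF ind continuous_map_product_borel_measurable(2)[OF f(1)]] by simp
    have "(\<lambda>\<omega>. \<lambda>k\<in>I. V k (\<omega> k)) \<in> measurable (PiM I \<Omega>) (PiM I (\<lambda>_. borel))"
      using ind by (intro measurable_restrict) (simp add: indep_vars_def)
    from measurable_compose[OF this continuous_map_product_borel_measurable(2)[OF f(1)]]
    show "(\<lambda>\<omega>. f (\<lambda>k\<in>I. V k (\<omega> k))) \<in> borel_measurable (PiM I \<Omega>)" .
  qed
  obtain B where "\<forall>x \<in> f ` topspace (product_topology (\<lambda>_. euclideanreal) I). norm x \<le> B"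
    using f(2) by (auto simp: bounded_iff)
  then have B: "norm (f (\<lambda>k\<in>I. x k)) \<le> B" for x by (auto simp: PiE_def)
  have "(\<lambda>n. \<integral>\<omega>. f (\<lambda>k\<in>I. Yn k n (\<omega> k)) \<partial>PiM I \<Omega>) \<longlonglongrightarrow> (\<integral>\<omega>. f (\<lambda>k\<in>I. Y k (\<omega> k)) \<partial>PiM I \<Omega>)"
  proof (rule integral_dominated_convergence[where w = "\<lambda>_. B"])
    show "AE \<omega> in PiM I \<Omega>. (\<lambda>n. f (\<lambda>k\<in>I. Yn k n (\<omega> k))) \<longlonglongrightarrow> f (\<lambda>k\<in>I. Y k (\<omega> k))"
    proof (rule AE_I2)
      fix \<omega> assume \<omega>: "\<omega> \<in> space (PiM I \<Omega>)"
      have "limitin (product_topology (\<lambda>_. euclideanreal) I) (\<lambda>n. \<lambda>k\<in>I. Yn k n (\<omega> k))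
          (\<lambda>k\<in>I. Y k (\<omega> k)) sequentially"
        using \<omega> lim by (auto simp: limitin_componentwise space_PiM PiE_iff)
      from continuous_map_limit[OF f(1) this]
      show "(\<lambda>n. f (\<lambda>k\<in>I. Yn k n (\<omega> k))) \<longlonglongrightarrow> f (\<lambda>k\<in>I. Y k (\<omega> k))"
        by (simp add: o_def)
    qed
    show "\<And>n. AE \<omega> in PiM I \<Omega>. norm (f (\<lambda>k\<in>I. Yn k n (\<omega> k))) \<le> B"
      using B by auto
  qed (use meas Yn Y in auto)
  moreover have "PiM I (\<lambda>k. distr (\<Omega> k) borel (Yn k n)) = PiM I (\<mu> n)" for n
    using Yn by (intro PiM_cong) auto
  moreover have "PiM I (\<lambda>k. distr (\<Omega> k) borel (Y k)) = PiM I \<nu>"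
    using Y by (intro PiM_cong) auto
  ultimately show ?thesis
    using law[of "\<lambda>k. Yn k n" for n, OF Yn(1)] law[of Y, OF Y(1)] by simp
qed

text \<open>On a compact cube a bounded continuous function is uniformly continuous. If some coordinate moves by
more than the resulting threshold, the bound on the function is absorbed by the quadratic term. In this form
the estimate can be integrated against an error known in mean square.\<close>
lemma continuous_on_product_modulus:
  fixes f :: "(nat \<Rightarrow> real) \<Rightarrow> real"
  assumes f: "continuous_map (product_topology (\<lambda>_. euclideanreal) I) euclideanreal f"
      "bounded (f ` topspace (product_topology (\<lambda>_. euclideanreal) I))"
    and I: "finite I" and \<epsilon>: "\<epsilon> > 0"
  shows "\<exists>K\<ge>0. \<forall>x y. (\<forall>k\<in>I. x k \<in> {l..u} \<and> y k \<in> {l..u}) \<longrightarrow>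
    \<bar>f (restrict x I) - f (restrict y I)\<bar> \<le> \<epsilon> + K * (\<Sum>k\<in>I. (x k - y k)\<^sup>2)"
proof -
  let ?C = "PiE UNIV (\<lambda>k. if k \<in> I then {l..u} else {0})"
  let ?e = "\<lambda>x k. if k \<in> I then x k else (0::real)"
  have re: "restrict (?e x) I = restrict x I" for x by (auto simp: restrict_def)
  have "compactin (product_topology (\<lambda>_. euclideanreal) UNIV) ?C"
    by (subst compactin_PiE) auto
  then have "compact ?C" by (simp add: euclidean_product_topology)
  then have "uniformly_continuous_on ?C (\<lambda>x. f (restrict x I))"
    using continuous_map_product_borel_measurable(1)[OF f(1)]
    by (intro compact_uniformly_continuous) (auto intro: continuous_on_subset)
  then obtain d where d: "d > 0"
    "\<And>x y. x \<in> ?C \<Longrightarrow> y \<in> ?C \<Longrightarrow> dist y x < d \<Longrightarrow> \<bar>f (restrict y I) - f (restrict x I)\<bar> < \<epsilon>"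
    using \<epsilon> unfolding uniformly_continuous_on_def dist_real_def by metis
  obtain B where "\<forall>x \<in> f ` topspace (product_topology (\<lambda>_. euclideanreal) I). norm x \<le> B"
    using f(2) by (auto simp: bounded_iff)
  then have B: "\<bar>f (restrict x I)\<bar> \<le> B" for x by (auto simp: PiE_def)
  then have B0: "0 \<le> B" using abs_ge_zero order_trans by blast
  define \<eta> where "\<eta> = d / 4"
  have \<eta>: "0 < \<eta>" "2 * \<eta> < d" using d(1) by (auto simp: \<eta>_def)
  have "\<bar>f (restrict x I) - f (restrict y I)\<bar> \<le> \<epsilon> + 2 * B / \<eta>\<^sup>2 * (\<Sum>k\<in>I. (x k - y k)\<^sup>2)"
    if xy: "\<forall>k\<in>I. x k \<in> {l..u} \<and> y k \<in> {l..u}" for x y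
  proof (cases "\<forall>k\<in>I. \<bar>x k - y k\<bar> \<le> \<eta>")
    case True
    have comp: "dist (?e x k) (?e y k) \<le> \<eta>" for k
      using True \<eta> by (auto simp: dist_real_def)
    have sm: "summable (\<lambda>n. (1 / 2) ^ n * min (dist (?e x (from_nat n)) (?e y (from_nat n))) 1)"
      by (rule summable_comparison_test'[where g = "\<lambda>n. (1 / 2) ^ n"]) (auto simp: summable_geometric_iff)
    have "dist (?e x) (?e y) \<le> (\<Sum>n. (1 / 2) ^ n * \<eta>)"
      unfolding dist_fun_def
    proof (rule suminf_le[OF _ sm])
      show "summable (\<lambda>n. (1 / 2) ^ n * \<eta>)" by (intro summable_mult2) simp
      fix n :: nat
      show "(1 / 2) ^ n * min (dist (?e x (from_nat n)) (?e y (from_nat n))) 1 \<le> (1 / 2) ^ n * \<eta>"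
        using comp[of "from_nat n"] by (intro mult_left_mono) auto
    qed
    also have "\<dots> = 2 * \<eta>"
      using suminf_geometric[of "1 / 2 :: real"] by (simp add: suminf_mult2[symmetric])
    finally have "dist (?e x) (?e y) < d" using \<eta> by simp
    then have "\<bar>f (restrict (?e x) I) - f (restrict (?e y) I)\<bar> < \<epsilon>"
      using xy by (intro d(2)) auto
    moreover have "0 \<le> 2 * B / \<eta>\<^sup>2 * (\<Sum>k\<in>I. (x k - y k)\<^sup>2)"
      using B0 by (intro mult_nonneg_nonneg sum_nonneg divide_nonneg_nonneg) auto
    ultimately show ?thesis unfolding re by linarith
  next
    case False
    then obtain k where k: "k \<in> I" "\<eta> < \<bar>x k - y k\<bar>" by auto
    have "\<eta>\<^sup>2 \<le> (x k - y k)\<^sup>2"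
      using k \<eta> by (subst abs_le_square_iff[symmetric]) auto
    also have "\<dots> \<le> (\<Sum>k\<in>I. (x k - y k)\<^sup>2)"
      using k I by (intro member_le_sum) auto
    finally have "2 * B / \<eta>\<^sup>2 * \<eta>\<^sup>2 \<le> 2 * B / \<eta>\<^sup>2 * (\<Sum>k\<in>I. (x k - y k)\<^sup>2)"
      using B0 by (intro mult_left_mono) auto
    moreover have "\<bar>f (restrict x I) - f (restrict y I)\<bar> \<le> 2 * B"
      using B[of x] B[of y] by linarith
    ultimately show ?thesis using \<epsilon> \<eta> by simp
  qed
  moreover have "0 \<le> 2 * B / \<eta>\<^sup>2" using B0 by simp
  ultimately show ?thesis by blast
qed

section \<open>The density of the limiting degree\<close>

lemma expint_inv_has_real_derivative [derivative_intros]: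
  assumes "(f has_real_derivative f') (at x)" "\<beta> * f x < 1"
  shows "((\<lambda>x. expint_inv \<beta> (f x)) has_real_derivative f' / (1 - \<beta> * f x)) (at x)"
proof (cases "\<beta> = 0")
  case True
  then show ?thesis using assms(1) by (simp add: expint_inv_def)
next
  case False
  then show ?thesis
    unfolding expint_inv_def using assms by (auto intro!: derivative_eq_intros simp: field_simps)
qed

text \<open>The derivative of the limiting degree in \<open>c\<close>, with \<open>t = exp (- \<beta> * c)\<close>: the derivative in \<open>t\<close> of the
quadratic polynomial \<open>t * (E 1 - E (1 - a) * t)\<close> divided by the factor \<open>E 1 - E (1 - a) * t\<close>.\<close>
definition degree_slope :: "real \<Rightarrow> real \<Rightarrow> real \<Rightarrow> real" where
  "degree_slope \<beta> a c =
     (expint \<beta> 1 - 2 * expint \<beta> (1 - a) * exp (- \<beta> * c)) /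
     (expint \<beta> 1 - expint \<beta> (1 - a) * exp (- \<beta> * c))"

text \<open>The limiting degree without the clamping, differentiable also at the ends of \<open>[0, a]\<close>.\<close>
definition smooth_degree :: "real \<Rightarrow> real \<Rightarrow> real \<Rightarrow> real" where
  "smooth_degree \<beta> a c = 2 * c + limit_height \<beta> a c - a"

lemma expint_1_split: "expint \<beta> 1 = expint \<beta> a + exp (- \<beta> * a) * expint \<beta> (1 - a)"
  using expint_add[of \<beta> a "1 - a"] by simp

text \<open>This is \<open>exp (- \<beta> * Y)\<close> for the limiting height \<open>Y\<close>, factored in terms of \<open>exp (- \<beta> * c)\<close>.\<close>
lemma one_minus_relative_height:
  assumes "0 < a"
  shows "1 - \<beta> * (expint \<beta> 1 * (expint \<beta> (a - c) / expint \<beta> a)) =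
    exp (\<beta> * c) * exp (- \<beta> * a) * (expint \<beta> 1 - expint \<beta> (1 - a) * exp (- \<beta> * c)) / expint \<beta> a"
proof -
  have E: "expint \<beta> a \<noteq> 0" using expint_pos[OF assms, of \<beta>] by simp
  have b: "\<beta> * expint \<beta> (a - c) = 1 - exp (- \<beta> * a) * exp (\<beta> * c)"
    using one_minus_expint[of \<beta> "a - c"] by (simp add: algebra_simps exp_add[symmetric])
  have c: "exp (\<beta> * c) * exp (- \<beta> * c) = 1" by (simp add: exp_add[symmetric])
  have "expint \<beta> a - expint \<beta> 1 * (\<beta> * expint \<beta> (a - c)) =
      exp (\<beta> * c) * exp (- \<beta> * a) * (expint \<beta> 1 - expint \<beta> (1 - a) * exp (- \<beta> * c))"
    unfolding b using expint_1_split[of \<beta> a] c by algebra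
  then show ?thesis using E by (simp add: field_simps)
qed

lemma slope_denominator_pos:
  assumes "0 < a" "c \<in> {0..a}"
  shows "0 < expint \<beta> 1 - expint \<beta> (1 - a) * exp (- \<beta> * c)"
proof -
  have "\<beta> * (expint \<beta> 1 * (expint \<beta> (a - c) / expint \<beta> a)) < 1"
    using relative_height_range[OF assms] by (intro expint_range_less)
  then have "0 < exp (\<beta> * c) * exp (- \<beta> * a) * (expint \<beta> 1 - expint \<beta> (1 - a) * exp (- \<beta> * c)) / expint \<beta> a"
    using one_minus_relative_height[OF assms(1), of \<beta> c] by linarith
  then have "0 < exp (\<beta> * c) * exp (- \<beta> * a) * (expint \<beta> 1 - expint \<beta> (1 - a) * exp (- \<beta> * c))"
    using expint_pos[OF assms(1), of \<beta>] by (simp add: zero_less_divide_iff)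
  then show ?thesis by (rule zero_less_mult_pos) simp
qed

lemma smooth_degree_has_real_derivative:
  assumes "0 < a" "c \<in> {0..a}"
  shows "(smooth_degree \<beta> a has_real_derivative degree_slope \<beta> a c) (at c)"
proof -
  let ?v = "\<lambda>c. expint \<beta> 1 * (expint \<beta> (a - c) / expint \<beta> a)"
  let ?D = "expint \<beta> 1 - expint \<beta> (1 - a) * exp (- \<beta> * c)"
  have E: "0 < expint \<beta> a" using assms(1) by (rule expint_pos)
  have D: "0 < ?D" by (rule slope_denominator_pos[OF assms])
  have lt: "\<beta> * ?v c < 1"
    using relative_height_range[OF assms] by (intro expint_range_less)
  have dv: "(?v has_real_derivative - (expint \<beta> 1 * exp (- \<beta> * (a - c)) / expint \<beta> a)) (at c)"
    using E by (auto intro!: derivative_eq_intros)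
  have "(smooth_degree \<beta> a has_real_derivative
      2 + - (expint \<beta> 1 * exp (- \<beta> * (a - c)) / expint \<beta> a) / (1 - \<beta> * ?v c)) (at c)"
    unfolding smooth_degree_def[abs_def] limit_height_def
    using DERIV_diff[OF DERIV_add[OF DERIV_cmult[OF DERIV_ident, of 2]
      expint_inv_has_real_derivative[OF dv lt]] DERIV_const[of a]] by simp
  also have "2 + - (expint \<beta> 1 * exp (- \<beta> * (a - c)) / expint \<beta> a) / (1 - \<beta> * ?v c) =
      degree_slope \<beta> a c"
  proof -
    have e: "exp (- \<beta> * (a - c)) = exp (\<beta> * c) * exp (- \<beta> * a)"
      by (simp add: exp_add[symmetric] algebra_simps)
    have "- (expint \<beta> 1 * exp (- \<beta> * (a - c)) / expint \<beta> a) / (1 - \<beta> * ?v c) = - expint \<beta> 1 / ?D"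
      unfolding one_minus_relative_height[OF assms(1)] e using E D by (simp add: field_simps)
    then show ?thesis
      using D by (simp add: degree_slope_def field_simps)
  qed
  finally show ?thesis .
qed

lemma continuous_on_degree_slope:
  assumes "0 < a"
  shows "continuous_on {0..a} (degree_slope \<beta> a)"
  unfolding degree_slope_def[abs_def] using slope_denominator_pos[OF assms, of _ \<beta>]
  by (intro continuous_intros) force

lemma smooth_degree_ends:
  assumes "0 < a"
  shows "smooth_degree \<beta> a 0 = 1 - a" "smooth_degree \<beta> a a = a"
proof -
  have "expint \<beta> a \<noteq> 0" using expint_pos[OF assms, of \<beta>] by simp
  then show "smooth_degree \<beta> a 0 = 1 - a" "smooth_degree \<beta> a a = a"
    using expint_inv_expint[of \<beta> 0] by (simp_all add: smooth_degree_def limit_height_def)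
qed

text \<open>In the variable \<open>t = exp (- \<beta> * c)\<close> the relation between the digit and the degree is quadratic.\<close>
lemma exp_smooth_degree:
  assumes "0 < a" "c \<in> {0..a}"
  shows "exp (- \<beta> * smooth_degree \<beta> a c) =
    exp (- \<beta> * c) * (expint \<beta> 1 - expint \<beta> (1 - a) * exp (- \<beta> * c)) / expint \<beta> a"
proof -
  have "exp (- \<beta> * smooth_degree \<beta> a c) =
      exp (- \<beta> * c) * exp (- \<beta> * c) * exp (\<beta> * a) * exp (- \<beta> * limit_height \<beta> a c)"
    by (simp add: smooth_degree_def exp_add[symmetric] algebra_simps)
  also have "exp (- \<beta> * limit_height \<beta> a c) = 1 - \<beta> * (expint \<beta> 1 * (expint \<beta> (a - c) / expint \<beta> a))"
    using expint_limit_height[OF assms, of \<beta>] one_minus_expint[of \<beta> "limit_height \<beta> a c"] by simp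
  also have "\<dots> = exp (\<beta> * c) * exp (- \<beta> * a) * (expint \<beta> 1 - expint \<beta> (1 - a) * exp (- \<beta> * c)) / expint \<beta> a"
    by (rule one_minus_relative_height[OF assms(1)])
  also have "exp (- \<beta> * c) * exp (- \<beta> * c) * exp (\<beta> * a) *
      (exp (\<beta> * c) * exp (- \<beta> * a) * (expint \<beta> 1 - expint \<beta> (1 - a) * exp (- \<beta> * c)) / expint \<beta> a) =
      (exp (- \<beta> * c) * exp (\<beta> * c)) * (exp (\<beta> * a) * exp (- \<beta> * a)) *
      (exp (- \<beta> * c) * (expint \<beta> 1 - expint \<beta> (1 - a) * exp (- \<beta> * c)) / expint \<beta> a)"
    by (simp only: mult_ac times_divide_eq_right)
  finally show ?thesis by (simp add: exp_add[symmetric])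
qed

lemma mallows_R_expint:
  assumes "0 < a"
  shows "mallows_R a \<beta> = 4 * exp (\<beta> * (a - 1)) * expint \<beta> (1 - a) * expint \<beta> a / (expint \<beta> 1)\<^sup>2"
proof (cases "\<beta> = 0")
  case True
  then show ?thesis by (simp add: mallows_R_def expint_def)
next
  case False
  define x where "x = exp (\<beta> * a)"
  define y where "y = exp \<beta>"
  have xy: "x > 0" "y > 0" "y \<noteq> 1" using False by (auto simp: x_def y_def)
  have e: "exp (a * \<beta>) = x" "exp (- (\<beta> * a)) = 1 / x" "exp (- \<beta>) = 1 / y"
      "exp (\<beta> * (a - 1)) = x / y" "exp (- (\<beta> * (1 - a))) = x / y"
    by (simp_all add: x_def y_def exp_minus exp_diff[symmetric] field_simps)
  show ?thesis
    using False xy unfolding mallows_R_def expint_def y_def[symmetric]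
    by (simp add: e y_def[symmetric]) (simp add: divide_simps power2_eq_square)
qed

text \<open>The radicand of \<open>mallows_g\<close> is, up to a positive factor, the discriminant of the quadratic equation
for \<open>t\<close>, hence the square of \<open>E 1 - 2 * E (1 - a) * t\<close>. So \<open>mallows_g\<close> is the density of the digit
divided by the absolute slope, which is the change of variables formula on one branch.\<close>
lemma mallows_g_slope:
  assumes a: "0 < a" "a \<le> 1" and c: "c \<in> {0..a}" and ne: "degree_slope \<beta> a c \<noteq> 0"
  shows "mallows_g a \<beta> (smooth_degree \<beta> a c) * \<bar>degree_slope \<beta> a c\<bar> = exp (- \<beta> * c) / expint \<beta> a"
proof (cases "\<beta> = 0")
  case True
  have sq: "1 - mallows_R a 0 = (1 - 2 * a)\<^sup>2"
    by (simp add: mallows_R_def power2_eq_square algebra_simps)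
  have s: "degree_slope \<beta> a c = (2 * a - 1) / a"
    using True by (simp add: degree_slope_def expint_def)
  then show ?thesis
    using True ne a by (simp add: mallows_g_def sq expint_def abs_minus_commute abs_divide)
next
  case False
  define t where "t = exp (- \<beta> * c)"
  define P where "P = expint \<beta> 1"
  define Q where "Q = expint \<beta> (1 - a)"
  define A where "A = expint \<beta> a"
  define z where "z = smooth_degree \<beta> a c"
  have pos: "0 < P" "0 < A" "0 < t" using a by (auto simp: P_def A_def t_def intro!: expint_pos)
  have D: "0 < P - Q * t"
    using slope_denominator_pos[OF a(1) c, of \<beta>] by (simp add: P_def Q_def t_def)
  have s: "degree_slope \<beta> a c = (P - 2 * Q * t) / (P - Q * t)"
    by (simp add: degree_slope_def P_def Q_def t_def)
  have N: "P - 2 * Q * t \<noteq> 0" using ne s by auto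
  have z: "exp (- \<beta> * z) = t * (P - Q * t) / A"
    using exp_smooth_degree[OF a(1) c, of \<beta>] by (simp add: z_def t_def P_def Q_def A_def)
  have "exp \<beta> * mallows_R a \<beta> = exp (\<beta> * a) * (4 * Q * A / P\<^sup>2)"
    unfolding mallows_R_expint[OF a(1)] P_def Q_def A_def
    by (simp add: exp_add[symmetric] algebra_simps power2_eq_square)
  also have "exp (\<beta> * a) = exp (\<beta> * (a + z)) * (t * (P - Q * t) / A)"
    unfolding z[symmetric] by (simp add: exp_add[symmetric] algebra_simps)
  finally have "exp \<beta> * mallows_R a \<beta> =
      exp (\<beta> * (a + z)) * (t * (P - Q * t) / A) * (4 * Q * A / P\<^sup>2)" .
  then have "exp (\<beta> * (a + z)) - exp \<beta> * mallows_R a \<beta> =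
      exp (\<beta> * (a + z)) * (1 - (t * (P - Q * t) / A) * (4 * Q * A / P\<^sup>2))"
    by (simp only: right_diff_distrib mult_1_right mult.assoc)
  also have "1 - (t * (P - Q * t) / A) * (4 * Q * A / P\<^sup>2) = ((P - 2 * Q * t) / P)\<^sup>2"
    using pos by (simp add: divide_simps power2_eq_square) (simp add: algebra_simps)
  finally have "sqrt (exp (\<beta> * (a + z)) - exp \<beta> * mallows_R a \<beta>) =
      sqrt (exp (\<beta> * (a + z))) * (\<bar>P - 2 * Q * t\<bar> / P)"
    using pos by (simp add: real_sqrt_mult abs_divide)
  also have "sqrt (exp (\<beta> * (a + z))) = exp (\<beta> * (a + z) / 2)"
    by (rule real_sqrt_unique) (simp_all add: power2_eq_square exp_add[symmetric])
  finally have sqrt: "sqrt (exp (\<beta> * (a + z)) - exp \<beta> * mallows_R a \<beta>) =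
      exp (\<beta> * (a + z) / 2) * (\<bar>P - 2 * Q * t\<bar> / P)" .
  have "exp (\<beta> * (a - z) / 2) = exp (- \<beta> * z) * exp (\<beta> * (a + z) / 2)"
    by (simp add: exp_add[symmetric] field_simps)
  moreover have P: "1 - exp (- \<beta>) = \<beta> * P" using False by (simp add: P_def expint_def)
  ultimately have "mallows_g a \<beta> z = exp (- \<beta> * z) / \<bar>P - 2 * Q * t\<bar>"
    using False pos N by (simp add: mallows_g_def sqrt)
  then have "mallows_g a \<beta> z = t * (P - Q * t) / (A * \<bar>P - 2 * Q * t\<bar>)"
    using z by simp
  then have "mallows_g a \<beta> z * \<bar>degree_slope \<beta> a c\<bar> = t / A"
    unfolding s using D N pos by (simp add: abs_divide)
  then show ?thesis by (simp add: z_def t_def A_def)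
qed

text \<open>Substitution along a monotone branch of either direction. Reading it from right to left expresses a
pushforward as an integral over the values, without inverting \<open>h\<close>; a singularity of \<open>f\<close> at a
critical value does no harm.\<close>
lemma nn_integral_substitution_segment:
  fixes f :: "real \<Rightarrow> ennreal" and h h' :: "real \<Rightarrow> real"
  assumes f [measurable]: "f \<in> borel_measurable borel"
    and h: "\<And>x. x \<in> {l..r} \<Longrightarrow> (h has_real_derivative h' x) (at x)" "continuous_on {l..r} h'"
    and sign: "(\<forall>x\<in>{l..r}. 0 \<le> h' x) \<or> (\<forall>x\<in>{l..r}. h' x \<le> 0)" and lr: "l < r"
  shows "(\<integral>\<^sup>+x. f x * indicator (closed_segment (h l) (h r)) x \<partial>lborel) =
    (\<integral>\<^sup>+x. f (h x) * ennreal \<bar>h' x\<bar> * indicator {l..r} x \<partial>lborel)"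
  using sign
proof
  assume s: "\<forall>x\<in>{l..r}. 0 \<le> h' x"
  have "h l \<le> h r"
  proof (rule DERIV_nonneg_imp_nondecreasing[of l r h])
    show "\<exists>y. (h has_real_derivative y) (at x) \<and> 0 \<le> y" if "l \<le> x" "x \<le> r" for x
      using h(1)[of x] s that by (intro exI[of _ "h' x"]) auto
  qed (use lr in simp)
  then have "(\<integral>\<^sup>+x. f x * indicator (closed_segment (h l) (h r)) x \<partial>lborel) =
      (\<integral>\<^sup>+x. f (h x) * ennreal (h' x) * indicator {l..r} x \<partial>lborel)"
    using nn_integral_substitution_aux[OF f _ h _ lr] s by (simp add: closed_segment_eq_real_ivl)
  also have "\<dots> = (\<integral>\<^sup>+x. f (h x) * ennreal \<bar>h' x\<bar> * indicator {l..r} x \<partial>lborel)"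
    using s by (intro nn_integral_cong) (auto split: split_indicator)
  finally show ?thesis .
next
  assume s: "\<forall>x\<in>{l..r}. h' x \<le> 0"
  have "h r \<le> h l"
  proof (rule DERIV_nonpos_imp_nonincreasing[of l r h])
    show "\<exists>y. (h has_real_derivative y) (at x) \<and> y \<le> 0" if "l \<le> x" "x \<le> r" for x
      using h(1)[of x] s that by (intro exI[of _ "h' x"]) auto
  qed (use lr in simp)
  then have seg: "closed_segment (h l) (h r) = {h r..h l}" by (simp add: closed_segment_eq_real_ivl)
  have "(\<integral>\<^sup>+x. f x * indicator (closed_segment (h l) (h r)) x \<partial>lborel) =
      (\<integral>\<^sup>+x. f (- x) * indicator {h r..h l} (- x) \<partial>lborel)"
    unfolding seg by (subst nn_integral_real_affine[where c = "-1" and t = 0]) auto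
  also have "\<dots> = (\<integral>\<^sup>+x. f (- x) * indicator {- h l..- h r} x \<partial>lborel)"
    by (intro nn_integral_cong) (auto split: split_indicator)
  also have "\<dots> = (\<integral>\<^sup>+x. f (- (- h x)) * ennreal (- h' x) * indicator {l..r} x \<partial>lborel)"
  proof (rule nn_integral_substitution_aux[OF _ _ _ _ _ lr])
    show "((\<lambda>x. - h x) has_real_derivative - h' x) (at x)" if "x \<in> {l..r}" for x
      using h(1)[OF that] by (rule DERIV_minus)
    show "continuous_on {l..r} (\<lambda>x. - h' x)" using h(2) by (rule continuous_on_minus)
  qed (use s in auto)
  also have "\<dots> = (\<integral>\<^sup>+x. f (h x) * ennreal \<bar>h' x\<bar> * indicator {l..r} x \<partial>lborel)"
    using s by (intro nn_integral_cong) (auto split: split_indicator)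
  finally show ?thesis .
qed

lemma borel_measurable_mallows_g [measurable]: "mallows_g a \<beta> \<in> borel_measurable borel"
  unfolding mallows_g_def[abs_def] by measurable

text \<open>A slope that vanishes at a single point does not affect the integral. This matters at the turning point,
where \<open>mallows_g\<close> has a zero denominator.\<close>
lemma pushforward_monotone_branch:
  assumes a: "0 < a" "a \<le> 1" and lr: "0 \<le> l" "l < r" "r \<le> a"
    and sign: "(\<forall>c\<in>{l..r}. 0 \<le> degree_slope \<beta> a c) \<or> (\<forall>c\<in>{l..r}. degree_slope \<beta> a c \<le> 0)"
    and zero: "\<And>c. c \<in> {l..r} \<Longrightarrow> degree_slope \<beta> a c = 0 \<Longrightarrow> c = p"
    and A [measurable]: "A \<in> sets borel"
  shows "(\<integral>\<^sup>+c. ennreal (exp (- \<beta> * c) / expint \<beta> a) * indicator {l..r} c *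
        indicator A (smooth_degree \<beta> a c) \<partial>lborel) =
    (\<integral>\<^sup>+z. ennreal (mallows_g a \<beta> z) *
        indicator (closed_segment (smooth_degree \<beta> a l) (smooth_degree \<beta> a r)) z * indicator A z \<partial>lborel)"
proof -
  let ?h = "smooth_degree \<beta> a" and ?s = "degree_slope \<beta> a"
  let ?f = "\<lambda>z. ennreal (mallows_g a \<beta> z) * indicator A z"
  have sub: "{l..r} \<subseteq> {0..a}" using lr by auto
  have "(\<integral>\<^sup>+z. ?f z * indicator (closed_segment (?h l) (?h r)) z \<partial>lborel) =
      (\<integral>\<^sup>+c. ?f (?h c) * ennreal \<bar>?s c\<bar> * indicator {l..r} c \<partial>lborel)"
  proof (rule nn_integral_substitution_segment[OF _ _ _ sign lr(2)])
    show "(?h has_real_derivative ?s c) (at c)" if "c \<in> {l..r}" for c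
      using that sub by (intro smooth_degree_has_real_derivative[OF a(1)]) auto
    show "continuous_on {l..r} ?s"
      using continuous_on_subset[OF continuous_on_degree_slope[OF a(1)] sub] .
  qed measurable
  also have "\<dots> = (\<integral>\<^sup>+c. ennreal (exp (- \<beta> * c) / expint \<beta> a) * indicator {l..r} c *
        indicator A (?h c) \<partial>lborel)"
  proof (rule nn_integral_cong_AE)
    show "AE c in lborel. ?f (?h c) * ennreal \<bar>?s c\<bar> * indicator {l..r} c =
        ennreal (exp (- \<beta> * c) / expint \<beta> a) * indicator {l..r} c * indicator A (?h c)"
      using AE_lborel_singleton[of p]
    proof eventually_elim
      case (elim c)
      show ?case
      proof (cases "c \<in> {l..r}")
        case True
        then have s: "?s c \<noteq> 0" using zero elim by auto
        have "ennreal (mallows_g a \<beta> (?h c)) * ennreal \<bar>?s c\<bar> = ennreal (exp (- \<beta> * c) / expint \<beta> a)"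
          using mallows_g_slope[OF a _ s] True sub
          by (subst ennreal_mult''[symmetric]) auto
        then show ?thesis using True by (simp add: mult_ac split: split_indicator)
      qed simp
    qed
  qed
  finally show ?thesis by (simp add: mult_ac)
qed

lemma emeasure_limit_degree_law:
  assumes a: "0 < a" and A [measurable]: "A \<in> sets borel"
  shows "emeasure (distr (limit_digit_law \<beta> a) borel (limit_degree \<beta> a)) A =
    (\<integral>\<^sup>+c. ennreal (exp (- \<beta> * c) / expint \<beta> a) * indicator {0..a} c *
        indicator A (smooth_degree \<beta> a c) \<partial>lborel)"
proof -
  have m [measurable]: "limit_degree \<beta> a \<in> borel_measurable borel"
    by (rule borel_measurable_continuous_onI[OF continuous_on_limit_degree[OF a]])
  have "emeasure (distr (limit_digit_law \<beta> a) borel (limit_degree \<beta> a)) A =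
      emeasure (limit_digit_law \<beta> a) (limit_degree \<beta> a -` A)"
    by (subst emeasure_distr) (auto simp: measurable_cong_sets[OF sets_limit_digit_law refl])
  also have "\<dots> = (\<integral>\<^sup>+c. ennreal (exp (- \<beta> * c) / expint \<beta> a) * indicator {0..a} c *
        indicator (limit_degree \<beta> a -` A) c \<partial>lborel)"
    unfolding limit_digit_law_def using measurable_sets[OF m A] by (subst emeasure_density) auto
  also have "\<dots> = (\<integral>\<^sup>+c. ennreal (exp (- \<beta> * c) / expint \<beta> a) * indicator {0..a} c *
        indicator A (smooth_degree \<beta> a c) \<partial>lborel)"
    by (intro nn_integral_cong)
      (auto simp: limit_degree_Icc smooth_degree_def split: split_indicator)
  finally show ?thesis .
qed

text \<open>So \<open>a\<^sub>c\<close> is the median of the law with density proportional to \<open>exp (- \<beta> * x)\<close> on \<open>[0, 1]\<close>, the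
limiting law of \<open>\<pi> 1 / n\<close>.\<close>
lemma expint_mallows_ac: "expint \<beta> (mallows_ac \<beta>) = expint \<beta> 1 / 2"
proof (cases "\<beta> = 0")
  case True
  then show ?thesis by (simp add: expint_def mallows_ac_def)
next
  case False
  have "exp (- (\<beta> * mallows_ac \<beta>)) = exp (- (\<beta> / 2) + ln (cosh (\<beta> / 2)))"
    using False by (simp add: mallows_ac_def algebra_simps)
  also have "\<dots> = exp (- (\<beta> / 2)) * cosh (\<beta> / 2)"
    by (subst exp_add) (simp add: exp_ln cosh_real_pos)
  also have "\<dots> = (1 + exp (- \<beta>)) / 2"
    by (simp add: cosh_def algebra_simps exp_add[symmetric])
  finally show ?thesis using False by (simp add: expint_def field_simps)
qed

text \<open>The numerator of the slope is \<open>E 1 - 2 * E (1 - a)\<close> at \<open>c = 0\<close> and, by the addition law,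
\<open>2 * E a - E 1\<close> at \<open>c = a\<close>.\<close>
lemma slope_numerator_ends:
  assumes a: "0 < a" "a \<le> 1"
  shows "0 < expint \<beta> 1 - 2 * expint \<beta> (1 - a) \<longleftrightarrow> 1 - a < mallows_ac \<beta>"
    "expint \<beta> 1 - 2 * expint \<beta> (1 - a) < 0 \<longleftrightarrow> mallows_ac \<beta> < 1 - a"
    "0 < expint \<beta> 1 - 2 * expint \<beta> (1 - a) * exp (- \<beta> * a) \<longleftrightarrow> mallows_ac \<beta> < a"
    "expint \<beta> 1 - 2 * expint \<beta> (1 - a) * exp (- \<beta> * a) < 0 \<longleftrightarrow> a < mallows_ac \<beta>"
  using expint_less_iff[of \<beta> "1 - a" "mallows_ac \<beta>"] expint_less_iff[of \<beta> "mallows_ac \<beta>" "1 - a"]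
    expint_less_iff[of \<beta> "mallows_ac \<beta>" a] expint_less_iff[of \<beta> a "mallows_ac \<beta>"]
    expint_1_split[of \<beta> a]
  unfolding expint_mallows_ac by (auto simp: mult.commute)

lemma exp_between:
  fixes \<beta> :: real
  assumes "c \<in> {l..r}"
  shows "min (exp (- \<beta> * l)) (exp (- \<beta> * r)) \<le> exp (- \<beta> * c)"
    "exp (- \<beta> * c) \<le> max (exp (- \<beta> * l)) (exp (- \<beta> * r))"
proof -
  have "\<beta> * l \<le> \<beta> * c \<and> \<beta> * c \<le> \<beta> * r \<or> \<beta> * r \<le> \<beta> * c \<and> \<beta> * c \<le> \<beta> * l"
    using assms by (cases "\<beta> \<ge> 0") (auto simp: mult_left_mono mult_left_mono_neg)
  then show "min (exp (- \<beta> * l)) (exp (- \<beta> * r)) \<le> exp (- \<beta> * c)"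
    "exp (- \<beta> * c) \<le> max (exp (- \<beta> * l)) (exp (- \<beta> * r))"
    by (auto simp: min_le_iff_disj le_max_iff_disj)
qed

lemma borel_measurable_degree_density [measurable]:
  "degree_density_outer a \<beta> \<in> borel_measurable borel"
  "degree_density_inner a \<beta> \<in> borel_measurable borel"
  unfolding degree_density_outer_def[abs_def] degree_density_inner_def[abs_def]
    closed_segment_eq_real_ivl
  by measurable

text \<open>The numerator of the slope is monotone in \<open>c\<close> and has the same sign at both ends of \<open>[0, a]\<close>, so the
degree is a monotone function of the digit.\<close>
lemma distr_limit_degree_outer:
  assumes a: "0 < a" "a \<le> 1" and out: "a \<notin> closed_segment (mallows_ac \<beta>) (1 - mallows_ac \<beta>)"
  shows "distr (limit_digit_law \<beta> a) borel (limit_degree \<beta> a) =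
    density lborel (\<lambda>z. ennreal (degree_density_outer a \<beta> z))"
proof (rule measure_eqI)
  fix A assume "A \<in> sets (distr (limit_digit_law \<beta> a) borel (limit_degree \<beta> a))"
  then have A [measurable]: "A \<in> sets borel" by simp
  let ?N = "\<lambda>c. expint \<beta> 1 - 2 * expint \<beta> (1 - a) * exp (- \<beta> * c)"
  have Q: "0 \<le> 2 * expint \<beta> (1 - a)" using a by (simp add: expint_nonneg)
  have N: "?N 0 \<le> ?N c \<or> ?N a \<le> ?N c" "?N c \<le> ?N 0 \<or> ?N c \<le> ?N a" if "c \<in> {0..a}" for c
  proof -
    have mono: "expint \<beta> 1 - 2 * expint \<beta> (1 - a) * y \<le> expint \<beta> 1 - 2 * expint \<beta> (1 - a) * x"
      if "x \<le> y" for x y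
      using mult_left_mono[OF that Q] by linarith
    show "?N 0 \<le> ?N c \<or> ?N a \<le> ?N c" "?N c \<le> ?N 0 \<or> ?N c \<le> ?N a"
      using exp_between[OF that, of \<beta>] mono unfolding min_le_iff_disj le_max_iff_disj by blast+
  qed
  have slope: "degree_slope \<beta> a c = ?N c / (expint \<beta> 1 - expint \<beta> (1 - a) * exp (- \<beta> * c))" for c
    by (simp add: degree_slope_def)
  have D: "0 < expint \<beta> 1 - expint \<beta> (1 - a) * exp (- \<beta> * c)" if "c \<in> {0..a}" for c
    by (rule slope_denominator_pos[OF a(1) that])
  have "(\<forall>c\<in>{0..a}. 0 < degree_slope \<beta> a c) \<or> (\<forall>c\<in>{0..a}. degree_slope \<beta> a c < 0)"
  proof -
    have "mallows_ac \<beta> < a \<and> 1 - a < mallows_ac \<beta> \<or> a < mallows_ac \<beta> \<and> mallows_ac \<beta> < 1 - a"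
      using out by (auto simp: closed_segment_eq_real_ivl split: if_splits)
    then have "0 < ?N a \<and> 0 < ?N 0 \<or> ?N a < 0 \<and> ?N 0 < 0"
      using slope_numerator_ends[OF a, of \<beta>] by simp
    then have "(\<forall>c\<in>{0..a}. 0 < ?N c) \<or> (\<forall>c\<in>{0..a}. ?N c < 0)"
    proof (elim disjE)
      assume *: "0 < ?N a \<and> 0 < ?N 0"
      have "0 < ?N c" if "c \<in> {0..a}" for c
        using N(1)[OF that] * by (elim disjE) linarith+
      then show ?thesis by blast
    next
      assume *: "?N a < 0 \<and> ?N 0 < 0"
      have "?N c < 0" if "c \<in> {0..a}" for c
        using N(2)[OF that] * by (elim disjE) linarith+
      then show ?thesis by blast
    qed
    then show ?thesis
      unfolding slope using D by (blast intro: divide_pos_pos divide_neg_pos)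
  qed
  then have sign: "(\<forall>c\<in>{0..a}. 0 \<le> degree_slope \<beta> a c) \<or> (\<forall>c\<in>{0..a}. degree_slope \<beta> a c \<le> 0)"
    and nz: "\<And>c. c \<in> {0..a} \<Longrightarrow> degree_slope \<beta> a c = 0 \<Longrightarrow> c = 0"
    by (auto intro: less_imp_le) force+
  have "emeasure (distr (limit_digit_law \<beta> a) borel (limit_degree \<beta> a)) A =
    (\<integral>\<^sup>+z. ennreal (mallows_g a \<beta> z) * indicator (closed_segment (1 - a) a) z * indicator A z \<partial>lborel)"
    using pushforward_monotone_branch[OF a order_refl a(1) order_refl sign nz A]
    unfolding emeasure_limit_degree_law[OF a(1) A] smooth_degree_ends[OF a(1)] .
  also have "\<dots> = (\<integral>\<^sup>+z. ennreal (degree_density_outer a \<beta> z) * indicator A z \<partial>lborel)"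
    by (intro nn_integral_cong)
      (auto simp: degree_density_outer_def closed_segment_commute split: split_indicator)
  also have "\<dots> = emeasure (density lborel (\<lambda>z. ennreal (degree_density_outer a \<beta> z))) A"
    by (subst emeasure_density) auto
  finally show "emeasure (distr (limit_digit_law \<beta> a) borel (limit_degree \<beta> a)) A =
    emeasure (density lborel (\<lambda>z. ennreal (degree_density_outer a \<beta> z))) A" .
qed simp

text \<open>The numerator of the slope changes sign at a single interior point \<open>p\<close>. The two branches
contribute \<open>mallows_g\<close> on the segments from \<open>1 - a\<close> to \<open>z\<close> and from \<open>z\<close> to \<open>a\<close>, which overlap
between \<open>z\<close> and the nearer of \<open>a\<close> and \<open>1 - a\<close>. The turning value \<open>z\<close> lies below both for \<open>\<beta> > 0\<close> and above
both for \<open>\<beta> < 0\<close>.\<close>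
lemma distr_limit_degree_inner:
  assumes a: "0 < a" "a \<le> 1" and inn: "a \<in> open_segment (mallows_ac \<beta>) (1 - mallows_ac \<beta>)"
  shows "distr (limit_digit_law \<beta> a) borel (limit_degree \<beta> a) =
    density lborel (\<lambda>z. ennreal (degree_density_inner a \<beta> z))"
proof (rule measure_eqI)
  fix A assume "A \<in> sets (distr (limit_digit_law \<beta> a) borel (limit_degree \<beta> a))"
  then have A [measurable]: "A \<in> sets borel" by simp
  let ?h = "smooth_degree \<beta> a"
  define P where "P = expint \<beta> 1"
  define Q where "Q = expint \<beta> (1 - a)"
  let ?N = "\<lambda>c. P - 2 * Q * exp (- \<beta> * c)"
  have slope: "degree_slope \<beta> a c = ?N c / (P - Q * exp (- \<beta> * c))" for c
    by (simp add: degree_slope_def P_def Q_def)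
  have D: "0 < P - Q * exp (- \<beta> * c)" if "c \<in> {0..a}" for c
    unfolding P_def Q_def by (rule slope_denominator_pos[OF a(1) that])
  have cases: "?N 0 < 0 \<and> 0 < ?N a \<or> 0 < ?N 0 \<and> ?N a < 0"
  proof -
    have "mallows_ac \<beta> < a \<and> mallows_ac \<beta> < 1 - a \<or> a < mallows_ac \<beta> \<and> 1 - a < mallows_ac \<beta>"
      using inn by (auto simp: open_segment_eq_real_ivl split: if_splits)
    then show ?thesis
      using slope_numerator_ends[OF a, of \<beta>] by (auto simp: P_def Q_def)
  qed
  have "\<beta> \<noteq> 0" using cases by auto
  have "Q \<ge> 0" using a by (simp add: Q_def expint_nonneg)
  have P: "0 < P" by (simp add: P_def expint_pos)
  have Q: "0 < Q" using cases P \<open>Q \<ge> 0\<close> by (cases "Q = 0") auto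
  have Apos: "0 < expint \<beta> a" using a by (simp add: expint_pos)
  \<comment> \<open>The vertex of the parabola \<open>t * (P - Q * t)\<close> is \<open>t = P / (2 * Q)\<close>.\<close>
  define p where "p = - ln (P / (2 * Q)) / \<beta>"
  have ep: "exp (- \<beta> * p) = P / (2 * Q)"
    using \<open>\<beta> \<noteq> 0\<close> P Q by (simp add: p_def)
  have p: "0 < p" "p < a" "0 < \<beta> \<longleftrightarrow> ?N 0 < 0"
  proof -
    have N: "?N c < 0 \<longleftrightarrow> exp (- \<beta> * p) < exp (- \<beta> * c)" "0 < ?N c \<longleftrightarrow> exp (- \<beta> * c) < exp (- \<beta> * p)" for c
      unfolding ep using Q by (auto simp: field_simps)
    then have *: "?N c < 0 \<longleftrightarrow> \<beta> * c < \<beta> * p" "0 < ?N c \<longleftrightarrow> \<beta> * p < \<beta> * c" for c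
      by simp_all
    have "0 < p \<and> p < a \<and> (0 < \<beta> \<longleftrightarrow> ?N 0 < 0)"
      using cases \<open>\<beta> \<noteq> 0\<close> a unfolding *
      by (cases "0 < \<beta>") (auto simp: mult_less_cancel_left zero_less_mult_iff mult_less_0_iff)
    then show "0 < p" "p < a" "0 < \<beta> \<longleftrightarrow> ?N 0 < 0" by auto
  qed
  have Nc: "?N c \<le> 0 \<longleftrightarrow> \<beta> * c \<le> \<beta> * p" "0 \<le> ?N c \<longleftrightarrow> \<beta> * p \<le> \<beta> * c" "?N c = 0 \<longleftrightarrow> c = p" for c
  proof -
    have "?N c \<le> 0 \<longleftrightarrow> exp (- \<beta> * p) \<le> exp (- \<beta> * c)" "0 \<le> ?N c \<longleftrightarrow> exp (- \<beta> * c) \<le> exp (- \<beta> * p)"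
      "?N c = 0 \<longleftrightarrow> exp (- \<beta> * p) = exp (- \<beta> * c)"
      unfolding ep using Q by (auto simp: field_simps)
    then show "?N c \<le> 0 \<longleftrightarrow> \<beta> * c \<le> \<beta> * p" "0 \<le> ?N c \<longleftrightarrow> \<beta> * p \<le> \<beta> * c" "?N c = 0 \<longleftrightarrow> c = p"
      using \<open>\<beta> \<noteq> 0\<close> by auto
  qed
  have zero: "c = p" if "c \<in> {0..a}" "degree_slope \<beta> a c = 0" for c
    using that D[OF that(1)] Nc(3)[of c] by (simp add: slope)
  have sign: "0 \<le> degree_slope \<beta> a c \<longleftrightarrow> \<beta> * p \<le> \<beta> * c" "degree_slope \<beta> a c \<le> 0 \<longleftrightarrow> \<beta> * c \<le> \<beta> * p"
    if "c \<in> {0..a}" for c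
    using D[OF that] Nc[of c] by (auto simp: slope zero_le_divide_iff divide_le_0_iff)
  have sign1: "(\<forall>c\<in>{0..p}. 0 \<le> degree_slope \<beta> a c) \<or> (\<forall>c\<in>{0..p}. degree_slope \<beta> a c \<le> 0)"
    using p sign \<open>\<beta> \<noteq> 0\<close> by (cases "0 < \<beta>") auto
  have sign2: "(\<forall>c\<in>{p..a}. 0 \<le> degree_slope \<beta> a c) \<or> (\<forall>c\<in>{p..a}. degree_slope \<beta> a c \<le> 0)"
    using p sign \<open>\<beta> \<noteq> 0\<close> by (cases "0 < \<beta>") auto
  define z where "z = 1 - a + ln (mallows_R a \<beta>) / \<beta>"
  have ez: "exp (- \<beta> * z) = P\<^sup>2 / (4 * Q * expint \<beta> a)"
  proof -
    have R: "mallows_R a \<beta> = exp (\<beta> * (a - 1)) * (4 * Q * expint \<beta> a / P\<^sup>2)"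
      by (simp add: mallows_R_expint[OF a(1)] P_def Q_def)
    have pos: "0 < 4 * Q * expint \<beta> a / P\<^sup>2" using P Q Apos by simp
    have "ln (mallows_R a \<beta>) = \<beta> * (a - 1) + ln (4 * Q * expint \<beta> a / P\<^sup>2)"
      unfolding R using pos by (subst ln_mult) auto
    then have "- \<beta> * z = - ln (4 * Q * expint \<beta> a / P\<^sup>2)"
      using \<open>\<beta> \<noteq> 0\<close> by (simp add: z_def field_simps)
    then have "exp (- \<beta> * z) = inverse (4 * Q * expint \<beta> a / P\<^sup>2)"
      using pos by (simp only: exp_minus exp_ln)
    then show ?thesis by simp
  qed
  have eh: "exp (- \<beta> * ?h c) = exp (- \<beta> * c) * (P - Q * exp (- \<beta> * c)) / expint \<beta> a" if "c \<in> {0..a}" for c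
    using exp_smooth_degree[OF a(1) that, of \<beta>] by (simp add: P_def Q_def)
  have "exp (- \<beta> * ?h p) = exp (- \<beta> * z)"
    using p Q P Apos by (simp only: eh ez ep less_imp_le atLeastAtMost_iff) (simp add: field_simps power2_eq_square)
  then have hp: "?h p = z" using \<open>\<beta> \<noteq> 0\<close> by simp
  have extreme: "\<beta> * z \<le> \<beta> * ?h c" if "c \<in> {0..a}" for c
  proof -
    \<comment> \<open>The vertex value dominates all values of the parabola.\<close>
    have "P\<^sup>2 / (4 * Q) - exp (- \<beta> * c) * (P - Q * exp (- \<beta> * c)) = (?N c)\<^sup>2 / (4 * Q)"
      using Q by (simp add: field_simps power2_eq_square)
    moreover have "0 \<le> (?N c)\<^sup>2 / (4 * Q)" using Q by simp
    ultimately have "exp (- \<beta> * c) * (P - Q * exp (- \<beta> * c)) / expint \<beta> a \<le> (P\<^sup>2 / (4 * Q)) / expint \<beta> a"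
      using Apos by (intro divide_right_mono) linarith+
    then have "exp (- \<beta> * ?h c) \<le> exp (- \<beta> * z)"
      unfolding eh[OF that] ez by simp
    then show ?thesis by simp
  qed
  have ends: "\<beta> * z \<le> \<beta> * (1 - a)" "\<beta> * z \<le> \<beta> * a"
    using extreme[of 0] extreme[of a] a by (simp_all add: smooth_degree_ends)
  let ?d = "\<lambda>c. ennreal (exp (- \<beta> * c) / expint \<beta> a)"
  let ?g = "\<lambda>z. ennreal (mallows_g a \<beta> z)"
  have m [measurable]: "smooth_degree \<beta> a \<in> borel_measurable borel"
    unfolding smooth_degree_def[abs_def] limit_height_def expint_inv_def expint_def by measurable
  have "emeasure (distr (limit_digit_law \<beta> a) borel (limit_degree \<beta> a)) A =
      (\<integral>\<^sup>+c. ?d c * indicator {0..p} c * indicator A (?h c) + ?d c * indicator {p..a} c * indicator A (?h c) \<partial>lborel)"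
    unfolding emeasure_limit_degree_law[OF a(1) A]
  proof (rule nn_integral_cong_AE)
    show "AE c in lborel. ?d c * indicator {0..a} c * indicator A (?h c) =
        ?d c * indicator {0..p} c * indicator A (?h c) + ?d c * indicator {p..a} c * indicator A (?h c)"
      using AE_lborel_singleton[of p] by eventually_elim (use p in \<open>auto split: split_indicator\<close>)
  qed
  also have "\<dots> = (\<integral>\<^sup>+c. ?d c * indicator {0..p} c * indicator A (?h c) \<partial>lborel) +
      (\<integral>\<^sup>+c. ?d c * indicator {p..a} c * indicator A (?h c) \<partial>lborel)"
    by (rule nn_integral_add) (unfold expint_def, measurable)
  also have "(\<integral>\<^sup>+c. ?d c * indicator {0..p} c * indicator A (?h c) \<partial>lborel) =
      (\<integral>\<^sup>+x. ?g x * indicator (closed_segment (1 - a) z) x * indicator A x \<partial>lborel)"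
    using pushforward_monotone_branch[OF a order_refl p(1) less_imp_le[OF p(2)] sign1 zero A] p
    unfolding smooth_degree_ends[OF a(1)] hp by simp
  also have "(\<integral>\<^sup>+c. ?d c * indicator {p..a} c * indicator A (?h c) \<partial>lborel) =
      (\<integral>\<^sup>+x. ?g x * indicator (closed_segment z a) x * indicator A x \<partial>lborel)"
    using pushforward_monotone_branch[OF a less_imp_le[OF p(1)] p(2) order_refl sign2 zero A] p
    unfolding smooth_degree_ends[OF a(1)] hp by simp
  also have "(\<integral>\<^sup>+x. ?g x * indicator (closed_segment (1 - a) z) x * indicator A x \<partial>lborel) +
      (\<integral>\<^sup>+x. ?g x * indicator (closed_segment z a) x * indicator A x \<partial>lborel) =
      (\<integral>\<^sup>+x. ?g x * indicator (closed_segment (1 - a) z) x * indicator A x +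
        ?g x * indicator (closed_segment z a) x * indicator A x \<partial>lborel)"
    by (rule nn_integral_add[symmetric]) (unfold closed_segment_eq_real_ivl, measurable)
  also have "\<dots> = (\<integral>\<^sup>+x. ennreal (degree_density_inner a \<beta> x) * indicator A x \<partial>lborel)"
  proof (rule nn_integral_cong_AE)
    show "AE x in lborel. ?g x * indicator (closed_segment (1 - a) z) x * indicator A x +
        ?g x * indicator (closed_segment z a) x * indicator A x =
        ennreal (degree_density_inner a \<beta> x) * indicator A x"
      \<comment> \<open>At \<open>a\<close> and \<open>1 - a\<close> the indicators of the closed segments and the case distinction in the
        density may disagree.\<close>
      using AE_lborel_singleton[of a] AE_lborel_singleton[of "1 - a"]
    proof eventually_elim
      case (elim x)
      have two: "ennreal (2 * y) = ennreal y + ennreal y" for y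
        by (cases "y \<ge> 0") (auto simp: ennreal_plus[symmetric] ennreal_neg)
      show ?case
      proof (cases "0 < \<beta>")
        case True
        then have "z \<le> 1 - a" "z \<le> a" using ends by auto
        then show ?thesis
          using elim unfolding degree_density_inner_def z_def[symmetric]
          by (auto simp: closed_segment_eq_real_ivl two min_def split: split_indicator if_splits)
      next
        case False
        then have "1 - a \<le> z" "a \<le> z" using ends \<open>\<beta> \<noteq> 0\<close> by auto
        then show ?thesis
          using elim unfolding degree_density_inner_def z_def[symmetric]
          by (auto simp: closed_segment_eq_real_ivl two min_def split: split_indicator if_splits)
      qed
    qed
  qed
  also have "\<dots> = emeasure (density lborel (\<lambda>z. ennreal (degree_density_inner a \<beta> z))) A"
    by (subst emeasure_density) auto
  finally show "emeasure (distr (limit_digit_law \<beta> a) borel (limit_degree \<beta> a)) A =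
    emeasure (density lborel (\<lambda>z. ennreal (degree_density_inner a \<beta> z))) A" .
qed simp

section \<open>Convergence of the degree process\<close>

lemma eventually_inj_on_site:
  fixes r :: "nat \<Rightarrow> real"
  assumes "finite I" "inj_on r I" "r ` I \<subseteq> {0<..1}"
  shows "\<forall>\<^sub>F n in sequentially. inj_on (\<lambda>k. site n (r k)) I"
proof -
  have lt: "\<forall>\<^sub>F n in sequentially. site n a \<noteq> site n b" if "a < b" "0 < a" "b \<le> 1" for a b :: real
  proof -
    have "\<forall>\<^sub>F n in sequentially. real (site n a) / n < (a + b) / 2"
      using that by (intro order_tendstoD(2)[OF scaled_site_tendsto]) auto
    moreover have "\<forall>\<^sub>F n in sequentially. (a + b) / 2 < real (site n b) / n"
      using that by (intro order_tendstoD(1)[OF scaled_site_tendsto]) auto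
    ultimately show ?thesis by eventually_elim auto
  qed
  have "\<forall>\<^sub>F n in sequentially. k \<noteq> l \<longrightarrow> site n (r k) \<noteq> site n (r l)" if "k \<in> I" "l \<in> I" for k l
  proof (cases "k = l")
    case False
    have "r k \<noteq> r l" using inj_onD[OF assms(2) _ that] False by blast
    moreover have "0 < r k" "r k \<le> 1" "0 < r l" "r l \<le> 1" using assms(3) that by auto
    ultimately have "\<forall>\<^sub>F n in sequentially. site n (r k) \<noteq> site n (r l)"
      using lt[of "r k" "r l"] lt[of "r l" "r k"] by (cases "r k < r l") (auto simp: eq_commute)
    then show ?thesis by eventually_elim simp
  qed simp
  then have "\<forall>\<^sub>F n in sequentially. \<forall>k\<in>I. \<forall>l\<in>I. k \<noteq> l \<longrightarrow> site n (r k) \<noteq> site n (r l)"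
    using assms(1) by (intro eventually_ball_finite ballI)
  then show ?thesis by eventually_elim (auto simp: inj_on_def)
qed

text \<open>The digits at distinct positions are independent, so the joint law is the product of the single laws.\<close>
lemma expectation_lehmer_digits:
  fixes F :: "(nat \<Rightarrow> real) \<Rightarrow> real"
  assumes n: "n \<ge> 1" and r: "r ` I \<subseteq> {0<..1}" and inj: "inj_on (\<lambda>k. site n (r k)) I"
    and F: "F \<in> borel_measurable (PiM I (\<lambda>_. borel))"
  shows "measure_pmf.expectation (mallows_pmf \<beta> n)
      (\<lambda>\<pi>. F (\<lambda>k\<in>I. real (lehmer_digit \<pi> (site n (r k))) / n)) =
    (\<integral>x. F x \<partial>PiM I (\<lambda>k. scaled_digit_law \<beta> (r k) n))"
proof -
  let ?P = "Pi_pmf {1..n} 0 (digit_pmf \<beta> n)"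
  have i: "site n (r k) \<in> {1..n}" if "k \<in> I" for k
    using site_bounds[OF n, of "r k"] r that by auto
  have "prob_space.indep_vars ?P (\<lambda>_. count_space UNIV) (\<lambda>x c. c x) ((\<lambda>k. site n (r k)) ` I)"
    using i by (intro prob_space.indep_vars_subset[OF measure_pmf.prob_space_axioms indep_vars_Pi_pmf]) auto
  from prob_space.indep_vars_reindex_inj[OF measure_pmf.prob_space_axioms inj this]
  have ind: "prob_space.indep_vars ?P (\<lambda>_. borel) (\<lambda>k c. real (c (site n (r k))) / n) I"
    by (rule prob_space.indep_vars_compose2[OF measure_pmf.prob_space_axioms]) simp
  have law: "distr ?P borel (\<lambda>c. real (c (site n (r k))) / n) = scaled_digit_law \<beta> (r k) n" if "k \<in> I" for k
  proof -
    have "scaled_digit_law \<beta> (r k) n =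
        distr (map_pmf (\<lambda>c. c (site n (r k))) ?P) borel (\<lambda>j. real j / n)"
      using i[OF that] by (simp add: scaled_digit_law_def Pi_pmf_component)
    then show ?thesis by (simp add: map_pmf_rep_eq distr_distr o_def)
  qed
  have "measure_pmf.expectation (mallows_pmf \<beta> n)
      (\<lambda>\<pi>. F (\<lambda>k\<in>I. real (lehmer_digit \<pi> (site n (r k))) / n)) =
      measure_pmf.expectation (mallows_pmf \<beta> n)
      (\<lambda>\<pi>. F (\<lambda>k\<in>I. real (lehmer_code n \<pi> (site n (r k))) / n))"
    using i by (intro arg_cong[where f = "measure_pmf.expectation _"] ext arg_cong[where f = F])
      (auto simp: lehmer_code_def restrict_def fun_eq_iff)
  also have "\<dots> = measure_pmf.expectation ?P (\<lambda>c. F (\<lambda>k\<in>I. real (c (site n (r k))) / n))"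
    unfolding map_lehmer_code_mallows_pmf[OF n, symmetric] by simp
  also have "\<dots> = (\<integral>x. F x \<partial>PiM I (\<lambda>k. distr ?P borel (\<lambda>c. real (c (site n (r k))) / n)))"
    by (rule prob_space.expectation_indep_vars[OF measure_pmf.prob_space_axioms ind F])
  also have "PiM I (\<lambda>k. distr ?P borel (\<lambda>c. real (c (site n (r k))) / n)) =
      PiM I (\<lambda>k. scaled_digit_law \<beta> (r k) n)"
    by (intro PiM_cong refl law)
  finally show ?thesis .
qed

lemma finite_set_mallows_pmf: "finite (set_pmf (mallows_pmf \<beta> n))"
proof -
  have "set_pmf (mallows_pmf \<beta> n) \<subseteq> {\<pi>. \<pi> permutes {1..n}}"
    by (auto simp: set_pmf_eq pmf_mallows_pmf)
  then show ?thesis by (rule finite_subset) (rule finite_permutations, simp)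
qed

text \<open>Both vectors lie in the cube with side \<open>[-1, 2]\<close>, so the modulus of continuity reduces the claim to
the mean square approximation of the single coordinates.\<close>
lemma degree_vector_expectation_approximation:
  fixes f :: "(nat \<Rightarrow> real) \<Rightarrow> real" and r :: "nat \<Rightarrow> real"
  assumes f: "continuous_map (product_topology (\<lambda>_. euclideanreal) I) euclideanreal f"
      "bounded (f ` topspace (product_topology (\<lambda>_. euclideanreal) I))"
    and I: "finite I" and r: "r ` I \<subseteq> {0<..1}"
  shows "(\<lambda>n. measure_pmf.expectation (mallows_pmf \<beta> n) (\<lambda>\<pi>. f (\<lambda>k\<in>I. degree_process n \<pi> (r k))) -
     measure_pmf.expectation (mallows_pmf \<beta> n)
       (\<lambda>\<pi>. f (\<lambda>k\<in>I. limit_degree \<beta> (r k) (real (lehmer_digit \<pi> (site n (r k))) / n)))) \<longlonglongrightarrow> 0"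
    (is "?D \<longlonglongrightarrow> 0")
proof (rule tendstoI)
  fix e :: real assume e: "0 < e"
  let ?E = "\<lambda>n. measure_pmf.expectation (mallows_pmf \<beta> n)"
  let ?x = "\<lambda>n \<pi> k. degree_process n \<pi> (r k)"
  let ?y = "\<lambda>n \<pi> k. limit_degree \<beta> (r k) (real (lehmer_digit \<pi> (site n (r k))) / n)"
  have rk: "0 < r k" "r k \<le> 1" if "k \<in> I" for k using r that by auto
  obtain K where K: "K \<ge> 0" "\<And>x y. (\<forall>k\<in>I. x k \<in> {-1..2} \<and> y k \<in> {-1..2}) \<Longrightarrow>
      \<bar>f (restrict x I) - f (restrict y I)\<bar> \<le> e / 2 + K * (\<Sum>k\<in>I. (x k - y k)\<^sup>2)"
    using continuous_on_product_modulus[OF f I, of "e / 2" "-1" 2] e by auto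
  have int: "integrable (mallows_pmf \<beta> n) g" for n and g :: "(nat \<Rightarrow> nat) \<Rightarrow> real"
    by (intro integrable_measure_pmf_finite finite_set_mallows_pmf)
  have bound: "\<bar>?D n\<bar> \<le> e / 2 + K * (\<Sum>k\<in>I. ?E n (\<lambda>\<pi>. (?x n \<pi> k - ?y n \<pi> k)\<^sup>2))" for n
  proof -
    have "\<bar>?D n\<bar> = \<bar>?E n (\<lambda>\<pi>. f (restrict (?x n \<pi>) I) - f (restrict (?y n \<pi>) I))\<bar>"
      by (subst Bochner_Integration.integral_diff) (auto simp: int)
    also have "\<dots> \<le> ?E n (\<lambda>\<pi>. \<bar>f (restrict (?x n \<pi>) I) - f (restrict (?y n \<pi>) I)\<bar>)"
      by (rule integral_abs_bound)
    also have "\<dots> \<le> ?E n (\<lambda>\<pi>. e / 2 + K * (\<Sum>k\<in>I. (?x n \<pi> k - ?y n \<pi> k)\<^sup>2))"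
      using rk by (intro integral_mono int K(2) ballI conjI degree_process_range limit_degree_range)
    also have "\<dots> = e / 2 + K * (\<Sum>k\<in>I. ?E n (\<lambda>\<pi>. (?x n \<pi> k - ?y n \<pi> k)\<^sup>2))"
      by (simp add: int)
    finally show ?thesis .
  qed
  have "(\<lambda>n. \<Sum>k\<in>I. ?E n (\<lambda>\<pi>. (?x n \<pi> k - ?y n \<pi> k)\<^sup>2)) \<longlonglongrightarrow> (\<Sum>k\<in>I. 0)"
    using rk by (intro tendsto_sum degree_process_L2_approximation)
  then have "(\<lambda>n. K * (\<Sum>k\<in>I. ?E n (\<lambda>\<pi>. (?x n \<pi> k - ?y n \<pi> k)\<^sup>2))) \<longlonglongrightarrow> K * 0"
    by (intro tendsto_mult_left) simp
  then have "\<forall>\<^sub>F n in sequentially. K * (\<Sum>k\<in>I. ?E n (\<lambda>\<pi>. (?x n \<pi> k - ?y n \<pi> k)\<^sup>2)) < e / 2"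
    using e by (intro order_tendstoD(2)[where y = "K * 0"]) auto
  then show "\<forall>\<^sub>F n in sequentially. dist (?D n) 0 < e"
  proof eventually_elim
    case (elim n)
    show ?case using bound[of n] elim by (simp only: dist_real_def diff_0_right)
  qed
qed

text \<open>The limiting digits at all times at once. The index type is the whole real line, so the indices outside
\<open>(0, 1]\<close> carry a point mass.\<close>
definition digit_field :: "real \<Rightarrow> (real \<Rightarrow> real) measure" where
  "digit_field \<beta> = PiM UNIV (\<lambda>a. if a \<in> {0<..1} then limit_digit_law \<beta> a else return borel 0)"

lemma prob_space_digit_law:
  "prob_space (if a \<in> {0<..1} then limit_digit_law \<beta> a else return borel 0)"
proof (cases "a \<in> {0<..1}")
  case True
  then interpret real_distribution "limit_digit_law \<beta> a"
    by (intro real_distribution_limit_digit_law) auto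
  show ?thesis using True prob_space_axioms by simp
next
  case False
  then show ?thesis by (simp only: if_False) (rule prob_space_return, simp)
qed

lemma prob_space_digit_field: "prob_space (digit_field \<beta>)"
  unfolding digit_field_def by (rule prob_space_PiM) (rule prob_space_digit_law)

lemma digit_field_coordinate:
  assumes "a \<in> {0<..1}"
  shows "(\<lambda>\<omega>. \<omega> a) \<in> borel_measurable (digit_field \<beta>)"
    and "distr (digit_field \<beta>) borel (\<lambda>\<omega>. \<omega> a) = limit_digit_law \<beta> a"
proof -
  let ?M = "\<lambda>a. if a \<in> {0<..1} then limit_digit_law \<beta> a else return borel 0"
  have "(\<lambda>\<omega>. \<omega> a) \<in> measurable (digit_field \<beta>) (?M a)"
    unfolding digit_field_def by (rule measurable_component_singleton) simp
  then show "(\<lambda>\<omega>. \<omega> a) \<in> borel_measurable (digit_field \<beta>)"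
    using assms by (simp add: measurable_cong_sets[OF refl sets_limit_digit_law])
  have "distr (digit_field \<beta>) (?M a) (\<lambda>\<omega>. \<omega> a) = ?M a"
    unfolding digit_field_def by (rule distr_PiM_component) (rule prob_space_digit_law, simp)
  then have "distr (digit_field \<beta>) (limit_digit_law \<beta> a) (\<lambda>\<omega>. \<omega> a) = limit_digit_law \<beta> a"
    using assms by simp
  moreover have "distr (digit_field \<beta>) (limit_digit_law \<beta> a) (\<lambda>\<omega>. \<omega> a) =
      distr (digit_field \<beta>) borel (\<lambda>\<omega>. \<omega> a)"
    by (rule distr_cong) auto
  ultimately show "distr (digit_field \<beta>) borel (\<lambda>\<omega>. \<omega> a) = limit_digit_law \<beta> a" by simp
qed

lemma indep_digit_field:
  assumes "r ` I \<subseteq> {0<..1}" "inj_on r I"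
  shows "prob_space.indep_vars (digit_field \<beta>) (\<lambda>_. borel) (\<lambda>k \<omega>. \<omega> (r k)) I"
proof -
  let ?M = "\<lambda>a. if a \<in> {0<..1} then limit_digit_law \<beta> a else return borel 0"
  interpret prob_space "digit_field \<beta>" by (rule prob_space_digit_field)
  have "indep_vars (\<lambda>k. ?M (r k)) (\<lambda>k \<omega>. \<omega> (r k)) I"
    unfolding digit_field_def using assms
    by (intro indep_vars_PiM_coordinates prob_space_digit_law) auto
  then show ?thesis
  proof (rule indep_vars_compose2[where Y = "\<lambda>_ x. x"])
    show "(\<lambda>x. x) \<in> measurable (?M (r k)) borel" if "k \<in> I" for k
      by (rule measurable_ident_sets) simp
  qed
qed

theorem theorem3p8:
  fixes \<beta> :: real
  shows "\<exists>(\<Omega> :: (real \<Rightarrow> real) measure) (Z :: real \<Rightarrow> (real \<Rightarrow> real) \<Rightarrow> real).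
    prob_space \<Omega> \<and>
    (\<forall>t\<in>{0<..1}. Z t \<in> borel_measurable \<Omega>) \<and>
    (\<forall>(s::nat) (r :: nat \<Rightarrow> real).
       r ` {1..s} \<subseteq> {0<..1} \<and> strict_mono_on {1..s} r \<longrightarrow>
         converges_in_distribution (product_topology (\<lambda>_. euclideanreal) {1..s})
           (\<lambda>n. measure_pmf (mallows_pmf \<beta> n)) (\<lambda>n \<pi>. \<lambda>k\<in>{1..s}. degree_process n \<pi> (r k))
           \<Omega> (\<lambda>\<omega>. \<lambda>k\<in>{1..s}. Z (r k) \<omega>) \<and>
         prob_space.indep_vars \<Omega> (\<lambda>_. borel) (\<lambda>k. Z (r k)) {1..s}) \<and>
    (\<forall>a\<in>{0<..1}. a \<notin> closed_segment (mallows_ac \<beta>) (1 - mallows_ac \<beta>) \<longrightarrow>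
       distributed \<Omega> lborel (Z a) (\<lambda>z. ennreal (degree_density_outer a \<beta> z))) \<and>
    (\<forall>a\<in>{0<..1}. a \<in> open_segment (mallows_ac \<beta>) (1 - mallows_ac \<beta>) \<longrightarrow>
       distributed \<Omega> lborel (Z a) (\<lambda>z. ennreal (degree_density_inner a \<beta> z)))"
proof (intro exI conjI ballI allI impI)
  let ?Z = "\<lambda>a \<omega>. limit_degree \<beta> a (\<omega> a)"
  interpret prob_space "digit_field \<beta>" by (rule prob_space_digit_field)
  show "prob_space (digit_field \<beta>)" by (rule prob_space_digit_field)
  have h: "limit_degree \<beta> a \<in> borel_measurable borel" if "a \<in> {0<..1}" for a
    using that by (intro borel_measurable_continuous_onI continuous_on_limit_degree) simp
  show Z: "?Z a \<in> borel_measurable (digit_field \<beta>)" if "a \<in> {0<..1}" for a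
    using measurable_compose[OF digit_field_coordinate(1)[OF that] h[OF that]] .
  have law: "distr (digit_field \<beta>) lborel (?Z a) = distr (limit_digit_law \<beta> a) borel (limit_degree \<beta> a)"
    if "a \<in> {0<..1}" for a
  proof -
    have "distr (digit_field \<beta>) lborel (?Z a) = distr (digit_field \<beta>) borel (?Z a)"
      by (rule distr_cong) auto
    also have "\<dots> = distr (distr (digit_field \<beta>) borel (\<lambda>\<omega>. \<omega> a)) borel (limit_degree \<beta> a)"
      using digit_field_coordinate(1)[OF that] h[OF that] by (subst distr_distr) (auto simp: o_def)
    finally show ?thesis by (simp add: digit_field_coordinate(2)[OF that])
  qed
  show "distributed (digit_field \<beta>) lborel (?Z a) (\<lambda>z. ennreal (degree_density_outer a \<beta> z))"
    if "a \<in> {0<..1}" "a \<notin> closed_segment (mallows_ac \<beta>) (1 - mallows_ac \<beta>)" for a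
    using that Z[OF that(1)] by (simp add: distributed_def law distr_limit_degree_outer)
  show "distributed (digit_field \<beta>) lborel (?Z a) (\<lambda>z. ennreal (degree_density_inner a \<beta> z))"
    if "a \<in> {0<..1}" "a \<in> open_segment (mallows_ac \<beta>) (1 - mallows_ac \<beta>)" for a
    using that Z[OF that(1)] by (simp add: distributed_def law distr_limit_degree_inner)
  fix s :: nat and r :: "nat \<Rightarrow> real"
  assume asm: "r ` {1..s} \<subseteq> {0<..1} \<and> strict_mono_on {1..s} r"
  let ?I = "{1..s}"
  have r: "r ` ?I \<subseteq> {0<..1}" and inj: "inj_on r ?I"
    using asm by (auto intro: strict_mono_on_imp_inj_on)
  have rk: "r k \<in> {0<..1}" if "k \<in> ?I" for k using r that by blast
  have ind: "indep_vars (\<lambda>_. borel) (\<lambda>k \<omega>. \<omega> (r k)) ?I"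
    by (rule indep_digit_field[OF r inj])
  show "indep_vars (\<lambda>_. borel) (\<lambda>k. ?Z (r k)) ?I"
    by (rule indep_vars_compose2[OF ind]) (rule h[OF rk])
  show "converges_in_distribution (product_topology (\<lambda>_. euclideanreal) ?I)
     (\<lambda>n. measure_pmf (mallows_pmf \<beta> n)) (\<lambda>n \<pi>. \<lambda>k\<in>?I. degree_process n \<pi> (r k))
     (digit_field \<beta>) (\<lambda>\<omega>. \<lambda>k\<in>?I. ?Z (r k) \<omega>)"
    unfolding converges_in_distribution_def
  proof (intro allI impI)
    fix f :: "(nat \<Rightarrow> real) \<Rightarrow> real"
    let ?T = "product_topology (\<lambda>_. euclideanreal) ?I"
    assume "continuous_map ?T euclideanreal f \<and> bounded (f ` topspace ?T)"
    then have f: "continuous_map ?T euclideanreal f" "bounded (f ` topspace ?T)" by auto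
    define H where "H x = (\<lambda>k\<in>?I. limit_degree \<beta> (r k) (x k))" for x :: "nat \<Rightarrow> real"
    have H: "continuous_map ?T ?T H"
    proof -
      have "continuous_map ?T euclideanreal (\<lambda>x. limit_degree \<beta> (r k) (x k))" if "k \<in> ?I" for k
      proof -
        have "continuous_map euclideanreal euclideanreal (limit_degree \<beta> (r k))"
          using continuous_on_limit_degree[of "r k" \<beta>] rk[OF that] by simp
        from continuous_map_compose[OF continuous_map_product_projection[OF that] this]
        show ?thesis by (simp add: o_def)
      qed
      then show ?thesis by (auto simp: continuous_map_componentwise H_def)
    qed
    have fH: "continuous_map ?T euclideanreal (f \<circ> H)" "bounded ((f \<circ> H) ` topspace ?T)"
    proof -
      show "continuous_map ?T euclideanreal (f \<circ> H)" by (rule continuous_map_compose[OF H f(1)])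
      have "H ` topspace ?T \<subseteq> topspace ?T" by (rule continuous_map_image_subset_topspace[OF H])
      then have "(f \<circ> H) ` topspace ?T \<subseteq> f ` topspace ?T" by (auto simp: image_comp[symmetric])
      then show "bounded ((f \<circ> H) ` topspace ?T)" by (rule bounded_subset[OF f(2)])
    qed
    note meas = continuous_map_product_borel_measurable(2)[OF fH(1)]
    have limit: "(\<integral>\<omega>. f (\<lambda>k\<in>?I. ?Z (r k) \<omega>) \<partial>digit_field \<beta>) =
        (\<integral>x. (f \<circ> H) x \<partial>PiM ?I (\<lambda>k. limit_digit_law \<beta> (r k)))"
    proof -
      have "(\<lambda>k\<in>?I. ?Z (r k) \<omega>) = H (\<lambda>k\<in>?I. \<omega> (r k))" for \<omega>
        by (auto simp: H_def)
      then have "(\<integral>\<omega>. f (\<lambda>k\<in>?I. ?Z (r k) \<omega>) \<partial>digit_field \<beta>) =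
          (\<integral>\<omega>. (f \<circ> H) (\<lambda>k\<in>?I. \<omega> (r k)) \<partial>digit_field \<beta>)"
        by simp
      also have "\<dots> = (\<integral>x. (f \<circ> H) x \<partial>PiM ?I (\<lambda>k. distr (digit_field \<beta>) borel (\<lambda>\<omega>. \<omega> (r k))))"
        by (rule expectation_indep_vars[OF ind meas])
      also have "PiM ?I (\<lambda>k. distr (digit_field \<beta>) borel (\<lambda>\<omega>. \<omega> (r k))) =
          PiM ?I (\<lambda>k. limit_digit_law \<beta> (r k))"
        by (intro PiM_cong refl digit_field_coordinate(2) rk)
      finally show ?thesis .
    qed
    let ?G = "\<lambda>n. measure_pmf.expectation (mallows_pmf \<beta> n)
       (\<lambda>\<pi>. f (\<lambda>k\<in>?I. limit_degree \<beta> (r k) (real (lehmer_digit \<pi> (site n (r k))) / n)))"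
    have "(\<lambda>n. \<integral>x. (f \<circ> H) x \<partial>PiM ?I (\<lambda>k. scaled_digit_law \<beta> (r k) n)) \<longlonglongrightarrow>
        (\<integral>x. (f \<circ> H) x \<partial>PiM ?I (\<lambda>k. limit_digit_law \<beta> (r k)))"
      using rk by (intro weak_conv_m_PiM fH real_distribution_scaled_digit_law
        real_distribution_limit_digit_law weak_conv_scaled_digit_law) auto
    moreover have "\<forall>\<^sub>F n in sequentially.
        (\<integral>x. (f \<circ> H) x \<partial>PiM ?I (\<lambda>k. scaled_digit_law \<beta> (r k) n)) = ?G n"
      using eventually_inj_on_site[OF finite_atLeastAtMost inj r] eventually_ge_at_top[of 1]
    proof eventually_elim
      case (elim n)
      have "(\<lambda>k\<in>?I. limit_degree \<beta> (r k) (real (lehmer_digit \<pi> (site n (r k))) / n)) =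
          H (\<lambda>k\<in>?I. real (lehmer_digit \<pi> (site n (r k))) / n)" for \<pi>
        by (auto simp: H_def)
      then show ?case
        using expectation_lehmer_digits[OF elim(2) r elim(1) meas, of \<beta>] by simp
    qed
    ultimately have "?G \<longlonglongrightarrow> (\<integral>\<omega>. f (\<lambda>k\<in>?I. ?Z (r k) \<omega>) \<partial>digit_field \<beta>)"
      unfolding limit by (rule Lim_transform_eventually)
    from tendsto_add[OF degree_vector_expectation_approximation[OF f finite_atLeastAtMost r, of \<beta>] this]
    show "(\<lambda>n. \<integral>\<pi>. f (\<lambda>k\<in>?I. degree_process n \<pi> (r k)) \<partial>measure_pmf (mallows_pmf \<beta> n)) \<longlonglongrightarrow>
        (\<integral>\<omega>. f (\<lambda>k\<in>?I. ?Z (r k) \<omega>) \<partial>digit_field \<beta>)"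
      by simp
  qed
qed

end
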